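(* Let $p$ be a prime number, $N$ a positive integer, and $G$ the cyclic group of order $p^N$ with generator $u$. Let $\mathbb{C}_p$ be the completion of the algebraic closure of $\mathbb{Q}_p$, with absolute value $|\cdot|$ extending the $p$-adic one. Set $\mathbf{q}_0:=\mathbf{t}-1$ and, for $1\le k\le N$, $\mathbf{q}_k:=\sum_{i=1}^p\mathbf{t}^{p^{k-1}(p-i)}$. For $0\le k\le N$ and $\omega\in[1,\infty)$, define $$\left|\sum_{l=0}^{p^N-1}a_lu^l\right|_{\bar\alpha_k^\omega}:=\left|\sum_{l=0}^{p^N-1}a_lr^l\right|^\omega\qquad(a_l\in\mathbb{Z}_p),$$ where $r$ is any root of $\mathbf{q}_k$ in $\mathbb{C}_p$ (the definition does not depend on the choice of the root $r$), and define $$\left|\sum_{l=0}^{p^N-1}a_lu^l\right|_{\bar\beta_1}:=\left|\sum_{l=0}^{p^N-1}\bar a_l\right|_0,$$ where $\bar a$ is the image of $a$ in $\mathbb{F}_p=\mathbb{Z}/p\mathbb{Z}$ and $|\cdot|_0$ is the trivial norm on $\mathbb{F}_p$. Then $$\mathcal{M}(\mathbb{Z}_p[G])=\{\bar\alpha_k^\omega:0\le k\le N,\ \omega\in[1,\infty)\}\cup\{\bar\beta_1\},$$ the elements $\bar\alpha_k^\omega$ for different $k$ are distinct, and as a topological space $\mathcal{M}(\mathbb{Z}_p[G])$ consists of $N+1$ intervals of the form $[1,\infty]$ (the $k$-th one being $\{\bar\alpha_k^\omega:\omega\in[1,\infty)\}\cup\{\bar\beta_1\}$, with $\bar\beta_1$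 corresponding to $\omega=\infty$) whose "$1$-ends" are all free and whose "$\infty$-ends" are all identified to the single point $\bar\beta_1$.
   Context: For a commutative unital Banach ring $(S,\|\cdot\|)$, its Berkovich spectrum $\mathcal{M}(S)$ is the set of all non-zero contractive multiplicative seminorms on $S$, with the topology of pointwise convergence. For a finite abelian group $G$, the group ring $S[G]$ is given the norm $\|\sum_{g\in G}a_gg\|:=\max_{g\in G}\|a_g\|$. Here $\mathbb{Z}_p$ is the ring of $p$-adic integers with the $p$-adic absolute value. *)

theory Defs
  imports "HOL-Analysis.Analysis" "HOL-Algebra.Algebraic_Closure" "HOL-Number_Theory.Residues"
begin

record 'a normed_ring = "'a ring" +
  rnorm :: "'a \<Rightarrow> real"

section \<open>The Berkovich spectrum\<close>

text \<open>
  Seminorms on a ring are taken to be extensional functions on its carrier (that is,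
  \<^term>\<open>undefined\<close> off the carrier), so that equality of seminorms is equality of functions and
  the topology of pointwise convergence is the product topology on the carrier.
\<close>

definition multiplicative_seminorm :: "('a, 'm) ring_scheme \<Rightarrow> ('a \<Rightarrow> real) \<Rightarrow> bool" where
  "multiplicative_seminorm S \<nu> \<longleftrightarrow>
     (\<forall>a\<in>carrier S. 0 \<le> \<nu> a) \<and>
     \<nu> \<zero>\<^bsub>S\<^esub> = 0 \<and>
     (\<forall>a\<in>carrier S. \<forall>b\<in>carrier S. \<nu> (a \<ominus>\<^bsub>S\<^esub> b) \<le> \<nu> a + \<nu> b) \<and>
     (\<forall>a\<in>carrier S. \<forall>b\<in>carrier S. \<nu> (a \<otimes>\<^bsub>S\<^esub> b) = \<nu> a * \<nu> b)"

definition berkovich_points :: "('a, 'm) normed_ring_scheme \<Rightarrow> ('a \<Rightarrow> real) set" where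
  "berkovich_points S =
     {\<nu> \<in> extensional (carrier S).
        multiplicative_seminorm S \<nu> \<and>
        (\<forall>a\<in>carrier S. \<nu> a \<le> rnorm S a) \<and>
        (\<exists>a\<in>carrier S. \<nu> a \<noteq> 0)}"

definition berkovich_spectrum :: "('a, 'm) normed_ring_scheme \<Rightarrow> ('a \<Rightarrow> real) topology" where
  "berkovich_spectrum S =
     subtopology (product_topology (\<lambda>_. euclideanreal) (carrier S)) (berkovich_points S)"

section \<open>Group rings of finite groups\<close>

text \<open>The function \<open>a\<close> stands for the sum of the \<open>a g \<cdot> g\<close>.\<close>

definition group_ring ::
    "('r, 'm) normed_ring_scheme \<Rightarrow> ('g, 'n) monoid_scheme \<Rightarrow> ('g \<Rightarrow> 'r) normed_ring" where
  "group_ring R G =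
     \<lparr>carrier = carrier G \<rightarrow>\<^sub>E carrier R,
      monoid.mult = (\<lambda>a b. \<lambda>g\<in>carrier G.
        \<Oplus>\<^bsub>R\<^esub>h\<in>carrier G. a h \<otimes>\<^bsub>R\<^esub> b (inv\<^bsub>G\<^esub> h \<otimes>\<^bsub>G\<^esub> g)),
      one = (\<lambda>g\<in>carrier G. if g = \<one>\<^bsub>G\<^esub> then \<one>\<^bsub>R\<^esub> else \<zero>\<^bsub>R\<^esub>),
      zero = (\<lambda>g\<in>carrier G. \<zero>\<^bsub>R\<^esub>),
      add = (\<lambda>a b. \<lambda>g\<in>carrier G. a g \<oplus>\<^bsub>R\<^esub> b g),
      rnorm = (\<lambda>a. Max ((\<lambda>g. rnorm R (a g)) ` carrier G))\<rparr>"

section \<open>The \<open>p\<close>-adic integers\<close>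

text \<open>
  The inverse limit of the rings of integers modulo \<open>p ^ n\<close>: \<open>x n\<close> is the representative in
  \<open>{0..<p ^ n}\<close> of \<open>x\<close> modulo \<open>p ^ n\<close>. For nonzero \<open>x\<close> the \<open>p\<close>-adic valuation is the largest \<open>n\<close>
  with \<open>x n = 0\<close>, equivalently the least \<open>n\<close> with \<open>x (n + 1) \<noteq> 0\<close>.
\<close>

definition Zp :: "nat \<Rightarrow> (nat \<Rightarrow> int) normed_ring" where
  "Zp p =
     \<lparr>carrier = {x. \<forall>n. x n \<in> {0..<int p ^ n} \<and> x (Suc n) mod int p ^ n = x n},
      monoid.mult = (\<lambda>x y n. (x n * y n) mod int p ^ n),
      one = (\<lambda>n. 1 mod int p ^ n),
      zero = (\<lambda>n. 0),
      add = (\<lambda>x y n. (x n + y n) mod int p ^ n),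
      rnorm = (\<lambda>x. if x = (\<lambda>n. 0) then 0 else (1 / real p) ^ (LEAST n. x (Suc n) \<noteq> 0))\<rparr>"

definition Zp_residue :: "(nat \<Rightarrow> int) \<Rightarrow> int" where
  "Zp_residue x = x 1"

definition trivial_norm :: "('a, 'm) ring_scheme \<Rightarrow> 'a \<Rightarrow> real" where
  "trivial_norm R x = (if x = \<zero>\<^bsub>R\<^esub> then 0 else 1)"

section \<open>The completed algebraic closure of the \<open>p\<close>-adic numbers\<close>

definition absolute_value :: "('a, 'm) normed_ring_scheme \<Rightarrow> bool" where
  "absolute_value K \<longleftrightarrow>
     (\<forall>x\<in>carrier K. 0 \<le> rnorm K x \<and> (rnorm K x = 0 \<longleftrightarrow> x = \<zero>\<^bsub>K\<^esub>)) \<and>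
     (\<forall>x\<in>carrier K. \<forall>y\<in>carrier K. rnorm K (x \<otimes>\<^bsub>K\<^esub> y) = rnorm K x * rnorm K y) \<and>
     (\<forall>x\<in>carrier K. \<forall>y\<in>carrier K. rnorm K (x \<oplus>\<^bsub>K\<^esub> y) \<le> rnorm K x + rnorm K y)"

definition complete_normed :: "('a, 'm) normed_ring_scheme \<Rightarrow> bool" where
  "complete_normed K \<longleftrightarrow>
     (\<forall>\<sigma>. (\<forall>n. \<sigma> n \<in> carrier K) \<and>
           (\<forall>\<epsilon>>0. \<exists>M::nat. \<forall>m\<ge>M. \<forall>n\<ge>M. rnorm K (\<sigma> m \<ominus>\<^bsub>K\<^esub> \<sigma> n) < \<epsilon>) \<longrightarrow>
           (\<exists>x\<in>carrier K. (\<lambda>n. rnorm K (\<sigma> n \<ominus>\<^bsub>K\<^esub> x)) \<longlonglongrightarrow> 0))"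

definition dense_in_normed :: "'a set \<Rightarrow> ('a, 'm) normed_ring_scheme \<Rightarrow> bool" where
  "dense_in_normed D K \<longleftrightarrow>
     D \<subseteq> carrier K \<and> (\<forall>x\<in>carrier K. \<forall>\<epsilon>>0. \<exists>y\<in>D. rnorm K (x \<ominus>\<^bsub>K\<^esub> y) < \<epsilon>)"

text \<open>
  The copy of the field of \<open>p\<close>-adic numbers (the fraction field of the \<open>p\<close>-adic integers) inside a
  field \<open>K\<close>, with respect to an embedding \<open>\<iota>\<close> of the \<open>p\<close>-adic integers in \<open>K\<close>.
\<close>

definition Qp_in :: "nat \<Rightarrow> ('c, 'm) ring_scheme \<Rightarrow> ((nat \<Rightarrow> int) \<Rightarrow> 'c) \<Rightarrow> 'c set" where
  "Qp_in p K \<iota> =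
     {\<iota> a \<otimes>\<^bsub>K\<^esub> inv\<^bsub>K\<^esub> (\<iota> b) | a b. a \<in> carrier (Zp p) \<and> b \<in> carrier (Zp p) - {\<zero>\<^bsub>Zp p\<^esub>}}"

text \<open>
  The field \<open>K\<close> with the embedding \<open>\<iota>\<close> is a completion of an algebraic closure \<open>A\<close> of the field of
  \<open>p\<close>-adic numbers, and its absolute value extends the \<open>p\<close>-adic one. This determines \<open>K\<close> up to
  isometric isomorphism.
\<close>

definition is_Cp :: "nat \<Rightarrow> ('c, 'm) normed_ring_scheme \<Rightarrow> ((nat \<Rightarrow> int) \<Rightarrow> 'c) \<Rightarrow> bool" where
  "is_Cp p K \<iota> \<longleftrightarrow>
     field K \<and> absolute_value K \<and> complete_normed K \<and>
     \<iota> \<in> ring_hom (Zp p) K \<and>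
     (\<forall>a\<in>carrier (Zp p). rnorm K (\<iota> a) = rnorm (Zp p) a) \<and>
     (\<exists>A. algebraic_closure (K\<lparr>carrier := A\<rparr>) (Qp_in p K \<iota>) \<and> dense_in_normed A K)"

section \<open>The seminorms on the group ring\<close>

definition q_poly :: "('c, 'm) ring_scheme \<Rightarrow> nat \<Rightarrow> nat \<Rightarrow> 'c list" where
  "q_poly R p k =
     (if k = 0 then X\<^bsub>R\<^esub> \<ominus>\<^bsub>poly_ring R\<^esub> \<one>\<^bsub>poly_ring R\<^esub>
      else (\<Oplus>\<^bsub>poly_ring R\<^esub>i\<in>{1..p}. X\<^bsub>R\<^esub> [^]\<^bsub>poly_ring R\<^esub> (p ^ (k - 1) * (p - i))))"

text \<open>
  Here \<open>u\<close> generates the cyclic group \<open>G\<close> of order \<open>p ^ N\<close>, so the coefficient \<open>a\<^sub>l\<close> of \<open>u ^ l\<close> in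
  \<open>a\<close> is the value of \<open>a\<close> at \<open>u ^ l\<close>. Note that \<open>0 powr \<omega> = 0\<close>.
\<close>

definition alpha_root ::
    "nat \<Rightarrow> nat \<Rightarrow> ('g, 'n) monoid_scheme \<Rightarrow> 'g \<Rightarrow> ('c, 'm) normed_ring_scheme \<Rightarrow>
     ((nat \<Rightarrow> int) \<Rightarrow> 'c) \<Rightarrow> 'c \<Rightarrow> real \<Rightarrow> ('g \<Rightarrow> nat \<Rightarrow> int) \<Rightarrow> real" where
  "alpha_root p N G u K \<iota> r \<omega> =
     (\<lambda>a\<in>carrier (group_ring (Zp p) G).
        rnorm K (\<Oplus>\<^bsub>K\<^esub>l\<in>{..<p ^ N}. \<iota> (a (u [^]\<^bsub>G\<^esub> l)) \<otimes>\<^bsub>K\<^esub> r [^]\<^bsub>K\<^esub> l) powr \<omega>)"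

definition alpha_bar ::
    "nat \<Rightarrow> nat \<Rightarrow> ('g, 'n) monoid_scheme \<Rightarrow> 'g \<Rightarrow> ('c, 'm) normed_ring_scheme \<Rightarrow>
     ((nat \<Rightarrow> int) \<Rightarrow> 'c) \<Rightarrow> nat \<Rightarrow> real \<Rightarrow> ('g \<Rightarrow> nat \<Rightarrow> int) \<Rightarrow> real" where
  "alpha_bar p N G u K \<iota> k \<omega> =
     alpha_root p N G u K \<iota> (SOME r. ring.is_root K (q_poly K p k) r) \<omega>"

definition beta_bar ::
    "nat \<Rightarrow> nat \<Rightarrow> ('g, 'n) monoid_scheme \<Rightarrow> 'g \<Rightarrow> ('g \<Rightarrow> nat \<Rightarrow> int) \<Rightarrow> real" where
  "beta_bar p N G u =
     (\<lambda>a\<in>carrier (group_ring (Zp p) G).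
        trivial_norm (residue_ring (int p))
          (\<Oplus>\<^bsub>residue_ring (int p)\<^esub>l\<in>{..<p ^ N}. Zp_residue (a (u [^]\<^bsub>G\<^esub> l))))"

definition interval_point ::
    "nat \<Rightarrow> nat \<Rightarrow> ('g, 'n) monoid_scheme \<Rightarrow> 'g \<Rightarrow> ('c, 'm) normed_ring_scheme \<Rightarrow>
     ((nat \<Rightarrow> int) \<Rightarrow> 'c) \<Rightarrow> nat \<Rightarrow> ereal \<Rightarrow> ('g \<Rightarrow> nat \<Rightarrow> int) \<Rightarrow> real" where
  "interval_point p N G u K \<iota> k w =
     (if w = \<infinity> then beta_bar p N G u else alpha_bar p N G u K \<iota> k (real_of_ereal w))"

end

theory Submission
  imports Defs "HOL-Real_Asymp.Real_Asymp"
begin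

text \<open>
  Write \<open>S\<close> for the group ring over the \<open>p\<close>-adic integers and \<open>x = u - 1\<close>. In characteristic \<open>p\<close> the
  element \<open>u\<close> is unipotent: \<open>x ^ (p ^ N)\<close> is a multiple of \<open>p\<close> (\<open>frobenius_power_one_plus\<close>). Every
  element of \<open>S\<close> is a constant plus a multiple of \<open>x\<close> (\<open>augmentation_decomposition\<close>), and a constant
  is a unit or a multiple of \<open>p\<close>, so that \<open>S\<close> is local with maximal ideal \<open>(p, x)\<close>. A point \<open>\<nu>\<close> of
  the spectrum is a multiplicative seminorm that is at most 1 on \<open>S\<close>, hence ultrametric
  (\<open>ultrametric\<close>), and \<open>\<nu>(p) \<le> 1 / p\<close> forces \<open>\<nu>(x) < 1\<close>. Elements outside the maximal ideal thus
  have seminorm 1, all others seminorm less than 1.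

  If \<open>\<nu>(p) = 0\<close>, then \<open>\<nu>\<close> vanishes on the maximal ideal, so \<open>\<nu>\<close> is \<open>\<beta>\<^sub>1\<close> (\<open>residual_seminorm\<close>).

  If \<open>\<nu>(p) > 0\<close>, then \<open>\<nu>(p) = p powr (- \<omega>)\<close> for a unique \<open>\<omega> \<ge> 1\<close>. Since \<open>u ^ (p ^ N) - 1\<close> is the
  product of the \<open>q\<^sub>k(u)\<close> and \<open>\<nu>\<close> is multiplicative, \<open>\<nu>\<close> kills some \<open>q\<^sub>k(u)\<close> (\<open>component_exists\<close>).
  For \<open>k \<ge> 1\<close> one has \<open>q\<^sub>k(u) = p + x h\<close>, so modulo \<open>q\<^sub>k(u)\<close> the maximal ideal is generated by \<open>x\<close>
  alone; for \<open>k = 0\<close>, where \<open>q\<^sub>0(u) = x\<close>, it is generated by \<open>p\<close> (\<open>uniformizer\<close>). Let \<open>\<pi>\<close> be that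
  generator. An element which is not a unit is \<open>\<pi>\<close> times another one, and iterating this shows that
  \<open>\<nu>(f)\<close> is zero or \<open>\<nu>(\<pi>) ^ m\<close> with an \<open>m\<close> which depends on \<open>f\<close> and \<open>k\<close>, but not on \<open>\<nu>\<close>
  (\<open>parallel_descent\<close>). Applied to \<open>f = p\<close> this determines \<open>\<nu>(\<pi>)\<close> from \<open>\<nu>(p)\<close>; so \<open>\<nu>\<close> is determined
  by \<open>k\<close> and \<open>\<omega>\<close> (\<open>seminorm_determined\<close>). This is, in elementary terms, the uniqueness of the extension
  of the absolute value to a totally ramified field, here the cyclotomic one.
  Evaluation at a root of \<open>q\<^sub>k\<close> in \<open>K\<close>, followed by the absolute value and the power \<open>\<omega>\<close>, is a
  seminorm of this kind; hence it is \<open>\<nu>\<close>, whichever root is taken.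

  For the topology, \<open>\<alpha>\<^sub>k(f) powr \<omega>\<close> tends to 0 or 1 as \<open>\<omega>\<close> tends to \<open>\<infinity>\<close> according to whether
  \<open>\<alpha>\<^sub>k(f)\<close> is less than 1 or equal to 1, and this limit is \<open>\<beta>\<^sub>1(f)\<close> (\<open>beta_residual\<close>). So each
  parametrization of an interval is continuous. The intervals are compact and the spectrum is
  Hausdorff, which makes the injective continuous maps embeddings and the surjective one a quotient map.
\<close>

section \<open>Multiplicative seminorms\<close>

locale seminormed_cring = cring R for R (structure) +
  fixes \<nu> :: "'a \<Rightarrow> real"
  assumes seminorm: "multiplicative_seminorm R \<nu>"
begin

lemma nonneg: "a \<in> carrier R \<Longrightarrow> 0 \<le> \<nu> a"
  and zero: "\<nu> \<zero> = 0"
  and minus_le: "\<lbrakk>a \<in> carrier R; b \<in> carrier R\<rbrakk> \<Longrightarrow> \<nu> (a \<ominus> b) \<le> \<nu> a + \<nu> b"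
  and mult: "\<lbrakk>a \<in> carrier R; b \<in> carrier R\<rbrakk> \<Longrightarrow> \<nu> (a \<otimes> b) = \<nu> a * \<nu> b"
  using seminorm by (auto simp: multiplicative_seminorm_def)

lemma neg: assumes a: "a \<in> carrier R" shows "\<nu> (\<ominus> a) = \<nu> a"
proof -
  have le: "\<nu> (\<ominus> b) \<le> \<nu> b" if "b \<in> carrier R" for b
    using minus_le[of \<zero> b] that by (simp add: minus_eq zero)
  show ?thesis using le[of a] le[of "\<ominus> a"] a by simp
qed

lemma add_le: "\<lbrakk>a \<in> carrier R; b \<in> carrier R\<rbrakk> \<Longrightarrow> \<nu> (a \<oplus> b) \<le> \<nu> a + \<nu> b"
  using minus_le[of a "\<ominus> b"] by (simp add: minus_eq neg)

lemma add_null: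
  assumes "a \<in> carrier R" "b \<in> carrier R" "\<nu> b = 0"
  shows "\<nu> (a \<oplus> b) = \<nu> a"
proof (rule antisym)
  show "\<nu> (a \<oplus> b) \<le> \<nu> a" using add_le[of a b] assms by simp
  have "(a \<oplus> b) \<ominus> b = a" using assms by (simp add: minus_eq a_assoc r_neg)
  then show "\<nu> a \<le> \<nu> (a \<oplus> b)" using minus_le[of "a \<oplus> b" b] assms by simp
qed

lemma one_cases: "\<nu> \<one> = 0 \<or> \<nu> \<one> = 1"
  using mult[of \<one> \<one>] by simp

lemma one: assumes "a \<in> carrier R" "\<nu> a \<noteq> 0" shows "\<nu> \<one> = 1"
  using mult[of \<one> a] assms by auto

lemma pow: assumes "\<nu> \<one> = 1" "a \<in> carrier R" shows "\<nu> (a [^] (n::nat)) = \<nu> a ^ n"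
  by (induction n) (auto simp: assms mult)

end

text \<open>
  These are the binary forms of degree \<open>n\<close> over \<open>Z\<close>. If \<open>Z\<close> contains 1 and is closed under addition,
  then \<open>(a + b) ^ n\<close> is one of them, and each has only \<open>n + 1\<close> terms: these two consequences of the
  binomial theorem make seminorms ultrametric.
\<close>

primrec horner_forms :: "('a, 'm) ring_scheme \<Rightarrow> 'a set \<Rightarrow> 'a \<Rightarrow> 'a \<Rightarrow> nat \<Rightarrow> 'a set" where
  "horner_forms R Z a b 0 = Z"
| "horner_forms R Z a b (Suc n) =
     {m \<otimes>\<^bsub>R\<^esub> b [^]\<^bsub>R\<^esub> Suc n \<oplus>\<^bsub>R\<^esub> a \<otimes>\<^bsub>R\<^esub> w | m w. m \<in> Z \<and> w \<in> horner_forms R Z a b n}"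

lemma power_le_linear_imp_le:
  fixes s M :: real
  assumes "0 \<le> s" "0 \<le> M" and le: "\<And>n. s ^ n \<le> (real n + 1) * M ^ n"
  shows "s \<le> M"
proof (rule ccontr)
  assume "\<not> s \<le> M"
  then have sM: "M < s" by simp
  have "M > 0"
  proof (rule ccontr)
    assume "\<not> M > 0"
    then show False using le[of 1] sM assms by simp
  qed
  define t where "t = s / M"
  have t: "t > 1" using sM \<open>M > 0\<close> by (simp add: t_def)
  have "((\<lambda>n. (real n + 1) / t ^ n) \<longlongrightarrow> 0) at_top" using t by real_asymp
  then have "\<forall>\<^sub>F n in at_top. (real n + 1) / t ^ n < 1"
    by (rule order_tendstoD) simp
  then obtain n where "(real n + 1) / t ^ n < 1"
    by (meson eventually_at_top_linorder order_refl)
  then have "real n + 1 < t ^ n" using t by (simp add: field_simps)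
  moreover have "t ^ n \<le> real n + 1"
    using le[of n] \<open>M > 0\<close> by (simp add: t_def power_divide field_simps)
  ultimately show False by simp
qed

context seminormed_cring
begin

text \<open>
  If the seminorm is at most 1 on a set of coefficients which is closed under addition, the \<open>n + 1\<close>
  terms of \<open>(a + b) ^ n\<close> bound \<open>\<nu> (a + b) ^ n\<close> by \<open>(n + 1) * max (\<nu> a) (\<nu> b) ^ n\<close>, and the linear
  factor disappears in the \<open>n\<close>-th root. For the seminorms on the group ring all elements can serve
  as coefficients.
\<close>

lemma ultrametric:
  assumes Z: "Z \<subseteq> carrier R" "\<one> \<in> Z" "\<And>m m'. \<lbrakk>m \<in> Z; m' \<in> Z\<rbrakk> \<Longrightarrow> m \<oplus> m' \<in> Z"
    and Z1: "\<And>m. m \<in> Z \<Longrightarrow> \<nu> m \<le> 1"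
    and [simp]: "a \<in> carrier R" "b \<in> carrier R"
  shows "\<nu> (a \<oplus> b) \<le> max (\<nu> a) (\<nu> b)"
proof (cases "\<nu> \<one> = 0")
  case True
  then have "\<nu> (a \<oplus> b) = 0" using mult[of \<one> "a \<oplus> b"] by simp
  then show ?thesis using nonneg[of a] by simp
next
  case False
  then have one1: "\<nu> \<one> = 1" using one_cases by simp
  let ?M = "max (\<nu> a) (\<nu> b)" and ?W = "horner_forms R Z a b"
  have M0: "0 \<le> ?M" using nonneg[of a] by simp
  have W: "?W n \<subseteq> carrier R" for n using Z(1) by (induction n) (auto intro!: a_closed m_closed)
  have bnd: "\<nu> w \<le> (real n + 1) * ?M ^ n" if "w \<in> ?W n" for n w
    using that
  proof (induction n arbitrary: w)
    case 0
    then show ?case using Z1 by simp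
  next
    case (Suc n)
    then obtain m w' where w: "m \<in> Z" "w' \<in> ?W n" "w = m \<otimes> b [^] Suc n \<oplus> a \<otimes> w'" by auto
    have c [simp]: "m \<in> carrier R" "w' \<in> carrier R" using w W Z(1) by auto
    have "\<nu> (m \<otimes> b [^] Suc n) \<le> 1 * ?M ^ Suc n"
      unfolding mult[OF c(1) nat_pow_closed[OF assms(6)]] pow[OF one1 assms(6)]
      using Z1[OF w(1)] power_mono[OF max.cobounded2[of "\<nu> b" "\<nu> a"] nonneg[OF assms(6)], of "Suc n"]
        zero_le_power[OF nonneg[OF assms(6)], of "Suc n"]
      by (intro mult_mono) simp_all
    moreover have "\<nu> (a \<otimes> w') \<le> ?M * ((real n + 1) * ?M ^ n)"
      unfolding mult[OF assms(5) c(2)] by (intro mult_mono Suc.IH w) (auto simp: nonneg M0)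
    ultimately have "\<nu> w \<le> 1 * ?M ^ Suc n + ?M * ((real n + 1) * ?M ^ n)"
      unfolding w(3) using add_le[of "m \<otimes> b [^] Suc n" "a \<otimes> w'"] by (simp del: nat_pow_Suc)
    then show ?case by (simp add: algebra_simps)
  qed
  have add_closed: "m \<otimes> b [^] n \<oplus> w \<in> ?W n" if mw: "m \<in> Z" "w \<in> ?W n" for m w n
  proof (cases n)
    case 0
    then show ?thesis using mw Z by auto
  next
    case (Suc k)
    then obtain m' w' where w: "m' \<in> Z" "w' \<in> ?W k" "w = m' \<otimes> b [^] Suc k \<oplus> a \<otimes> w'"
      using mw Suc by auto
    have [simp]: "m \<in> carrier R" "m' \<in> carrier R" "w' \<in> carrier R" using w mw W Z(1) by auto
    have "m \<otimes> b [^] n \<oplus> w = (m \<oplus> m') \<otimes> b [^] Suc k \<oplus> a \<otimes> w'"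
      by (simp add: Suc w l_distr a_assoc del: nat_pow_Suc)
    then show ?thesis using w mw Z(3) unfolding Suc horner_forms.simps by blast
  qed
  have mul: "(a \<oplus> b) \<otimes> w \<in> ?W (Suc n)" if "w \<in> ?W n" for w n
    using that
  proof (induction n arbitrary: w)
    case 0
    then have [simp]: "w \<in> carrier R" using Z(1) by auto
    have "(a \<oplus> b) \<otimes> w = w \<otimes> b [^] Suc 0 \<oplus> a \<otimes> w" by (simp add: l_distr r_distr a_ac m_ac)
    then show ?case using 0 by auto
  next
    case (Suc n)
    then obtain m w' where w: "m \<in> Z" "w' \<in> ?W n" "w = m \<otimes> b [^] Suc n \<oplus> a \<otimes> w'" by auto
    have [simp]: "m \<in> carrier R" "w' \<in> carrier R" using w W Z(1) by auto
    have "(a \<oplus> b) \<otimes> w =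
        m \<otimes> b [^] Suc (Suc n) \<oplus> a \<otimes> (m \<otimes> b [^] Suc n \<oplus> (a \<oplus> b) \<otimes> w')"
      unfolding w(3) by (simp add: l_distr r_distr a_ac m_ac)
    moreover have "m \<otimes> b [^] Suc n \<oplus> (a \<oplus> b) \<otimes> w' \<in> ?W (Suc n)"
      using add_closed[OF w(1) Suc.IH[OF w(2)]] .
    ultimately show ?case using w(1) by (subst horner_forms.simps) blast
  qed
  have "(a \<oplus> b) [^] n \<in> ?W n" for n
  proof (induction n)
    case (Suc n)
    then show ?case using mul[OF Suc] by (simp add: m_comm)
  qed (use Z in simp)
  then have "\<nu> (a \<oplus> b) ^ n \<le> (real n + 1) * ?M ^ n" for n
    using bnd[of "(a \<oplus> b) [^] n" n] pow[OF one1, of "a \<oplus> b" n] by simp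
  then show ?thesis by (rule power_le_linear_imp_le[rotated 2]) (auto simp: nonneg M0)
qed

end

section \<open>The Frobenius map modulo a prime\<close>

context cring
begin

lemma binomial_one_plus:
  assumes [simp]: "x \<in> carrier R"
  shows "(x \<oplus> \<one>) [^] n = (\<Oplus>i\<in>{..n}. [(n choose i)] \<cdot> (x [^] i))"
proof (induction n)
  case 0
  then show ?case by simp
next
  case (Suc n)
  let ?f = "\<lambda>n i. [(n choose i)] \<cdot> (x [^] (i::nat))"
  have [simp]: "?f m i \<in> carrier R" for m i by simp
  have "(\<Oplus>i\<in>{..Suc n}. ?f (Suc n) i) = (\<Oplus>i\<in>{..n}. ?f (Suc n) (Suc i)) \<oplus> \<one>"
    by (subst finsum_Suc2) auto
  also have "(\<Oplus>i\<in>{..n}. ?f (Suc n) (Suc i)) =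
      (\<Oplus>i\<in>{..n}. ?f n i \<otimes> x \<oplus> ?f n (Suc i))"
    by (intro finsum_cong') (auto simp: add.nat_pow_mult[symmetric] add_pow_ldistr)
  also have "\<dots> = (\<Oplus>i\<in>{..n}. ?f n i) \<otimes> x \<oplus> (\<Oplus>i\<in>{..n}. ?f n (Suc i))"
    by (subst finsum_addf) (auto simp: finsum_ldistr)
  also have "\<dots> \<oplus> \<one> = (\<Oplus>i\<in>{..n}. ?f n i) \<otimes> x \<oplus> ((\<Oplus>i\<in>{..n}. ?f n (Suc i)) \<oplus> \<one>)"
    by (intro a_assoc) auto
  also have "(\<Oplus>i\<in>{..n}. ?f n (Suc i)) \<oplus> \<one> = (\<Oplus>i\<in>{..Suc n}. ?f n i)"
    by (subst finsum_Suc2) auto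
  also have "\<dots> = (\<Oplus>i\<in>{..n}. ?f n i)"
    by (subst finsum_Suc) (auto simp: binomial_eq_0)
  also have "(\<Oplus>i\<in>{..n}. ?f n i) \<otimes> x \<oplus> (\<Oplus>i\<in>{..n}. ?f n i) = (x \<oplus> \<one>) [^] n \<otimes> (x \<oplus> \<one>)"
    unfolding Suc.IH[symmetric] by (simp add: r_distr)
  finally show ?case by simp
qed

lemma frobenius_one_plus:
  assumes p: "Factorial_Ring.prime (p::nat)" and x [simp]: "x \<in> carrier R"
  shows "\<exists>s\<in>carrier R. (x \<oplus> \<one>) [^] p = x [^] p \<oplus> \<one> \<oplus> [p] \<cdot> \<one> \<otimes> s"
proof -
  let ?f = "\<lambda>i. [(p choose i)] \<cdot> (x [^] (i::nat))"
  obtain m where m: "p = Suc (Suc m)"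
    using prime_ge_2_nat[OF p] by (metis add_2_eq_Suc le_Suc_ex)
  have "?f (Suc i) = [p] \<cdot> \<one> \<otimes> ([((p choose Suc i) div p)] \<cdot> (x [^] Suc i))" if "i \<le> m" for i
  proof -
    have "p dvd (p choose Suc i)" using that p m by (intro dvd_choose_prime) auto
    then have "(p choose Suc i) = ((p choose Suc i) div p) * p" by simp
    then have "?f (Suc i) = [p] \<cdot> ([((p choose Suc i) div p)] \<cdot> (x [^] Suc i))"
      by (metis add.nat_pow_pow x nat_pow_closed)
    then show ?thesis by (simp add: add_pow_ldistr)
  qed
  then have "(\<Oplus>i\<in>{..m}. ?f (Suc i)) =
      (\<Oplus>i\<in>{..m}. [p] \<cdot> \<one> \<otimes> ([((p choose Suc i) div p)] \<cdot> (x [^] Suc i)))"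
    by (intro finsum_cong') auto
  also have "\<dots> = [p] \<cdot> \<one> \<otimes> (\<Oplus>i\<in>{..m}. [((p choose Suc i) div p)] \<cdot> (x [^] Suc i))"
    by (subst finsum_rdistr) auto
  finally obtain s where s [simp]: "s \<in> carrier R" and mid: "(\<Oplus>i\<in>{..m}. ?f (Suc i)) = [p] \<cdot> \<one> \<otimes> s"
    by (metis (no_types, lifting) finsum_closed Pi_I add.nat_pow_closed nat_pow_closed x)
  have "(x \<oplus> \<one>) [^] p = (\<Oplus>i\<in>{..p}. ?f i)" by (rule binomial_one_plus[OF x])
  also have "\<dots> = ?f p \<oplus> (\<Oplus>i\<in>{..Suc m}. ?f i)"
    unfolding m by (subst finsum_Suc) auto
  also have "(\<Oplus>i\<in>{..Suc m}. ?f i) = [p] \<cdot> \<one> \<otimes> s \<oplus> \<one>"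
    using mid by (subst finsum_Suc2) auto
  also have "?f p = x [^] p" by simp
  also have "x [^] p \<oplus> ([p] \<cdot> \<one> \<otimes> s \<oplus> \<one>) = x [^] p \<oplus> \<one> \<oplus> [p] \<cdot> \<one> \<otimes> s"
    by (subst a_comm[of "[p] \<cdot> \<one> \<otimes> s"]) (simp_all add: a_assoc)
  finally have "(x \<oplus> \<one>) [^] p = x [^] p \<oplus> \<one> \<oplus> [p] \<cdot> \<one> \<otimes> s" .
  then show ?thesis by (intro bexI[of _ s]) simp_all
qed

lemma pow_add_multiple:
  assumes [simp]: "P \<in> carrier R" "y \<in> carrier R" "s \<in> carrier R"
  shows "\<exists>t\<in>carrier R. (y \<oplus> P \<otimes> s) [^] (m::nat) = y [^] m \<oplus> P \<otimes> t"
proof (induction m)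
  case 0
  then show ?case by (intro bexI[of _ \<zero>]) auto
next
  case (Suc m)
  then obtain t where [simp]: "t \<in> carrier R" and t: "(y \<oplus> P \<otimes> s) [^] m = y [^] m \<oplus> P \<otimes> t" by blast
  have "(y \<oplus> P \<otimes> s) [^] Suc m = y [^] Suc m \<oplus> P \<otimes> (y [^] m \<otimes> s \<oplus> t \<otimes> y \<oplus> t \<otimes> P \<otimes> s)"
    by (simp add: t) (simp add: l_distr r_distr a_ac m_ac)
  then show ?case by (intro bexI) auto
qed

lemma frobenius_power_one_plus:
  assumes p: "Factorial_Ring.prime (p::nat)" and x [simp]: "x \<in> carrier R"
  shows "\<exists>s\<in>carrier R. (x \<oplus> \<one>) [^] (p ^ n) = x [^] (p ^ n) \<oplus> \<one> \<oplus> [p] \<cdot> \<one> \<otimes> s"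
proof (induction n)
  case 0
  show ?case by (intro bexI[of _ \<zero>]) auto
next
  case (Suc n)
  let ?P = "[p] \<cdot> \<one>"
  from Suc obtain s where [simp]: "s \<in> carrier R"
    and s: "(x \<oplus> \<one>) [^] (p ^ n) = x [^] (p ^ n) \<oplus> \<one> \<oplus> ?P \<otimes> s" by blast
  obtain t where [simp]: "t \<in> carrier R"
    and t: "(x [^] (p ^ n) \<oplus> \<one> \<oplus> ?P \<otimes> s) [^] p = (x [^] (p ^ n) \<oplus> \<one>) [^] p \<oplus> ?P \<otimes> t"
    using pow_add_multiple[of ?P "x [^] (p ^ n) \<oplus> \<one>" s p] by auto
  obtain w where [simp]: "w \<in> carrier R"
    and w: "(x [^] (p ^ n) \<oplus> \<one>) [^] p = (x [^] (p ^ n)) [^] p \<oplus> \<one> \<oplus> ?P \<otimes> w"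
    using frobenius_one_plus[OF p, of "x [^] (p ^ n)"] by auto
  have "(x \<oplus> \<one>) [^] (p ^ Suc n) = x [^] (p ^ Suc n) \<oplus> \<one> \<oplus> ?P \<otimes> w \<oplus> ?P \<otimes> t"
    using s t w by (simp add: nat_pow_pow[symmetric] mult.commute[of p])
  also have "\<dots> = x [^] (p ^ Suc n) \<oplus> \<one> \<oplus> ?P \<otimes> (w \<oplus> t)"
    by (simp add: r_distr a_assoc)
  finally show ?case by (intro bexI[of _ "w \<oplus> t"]) auto
qed

end

section \<open>The polynomials whose roots are the primitive roots of unity\<close>

text \<open>
  The Horner form, unlike a finite sum over an index set, does not refer to the carrier of the ring,
  so its values in a subfield of \<open>K\<close> and in \<open>K\<close> agree by mere unfolding.
\<close>

primrec geometric_sum :: "('a, 'm) ring_scheme \<Rightarrow> 'a \<Rightarrow> nat \<Rightarrow> 'a" where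
  "geometric_sum R y 0 = \<one>\<^bsub>R\<^esub>"
| "geometric_sum R y (Suc n) = geometric_sum R y n \<otimes>\<^bsub>R\<^esub> y \<oplus>\<^bsub>R\<^esub> \<one>\<^bsub>R\<^esub>"

text \<open>
  The value of the polynomial \<open>q\<^sub>k\<close> at an element \<open>y\<close> of an arbitrary ring: it is used for \<open>u\<close> in the
  group ring, for roots of unity in \<open>K\<close>, and for the variable in polynomial rings.
\<close>

definition q_at :: "('a, 'm) ring_scheme \<Rightarrow> nat \<Rightarrow> nat \<Rightarrow> 'a \<Rightarrow> 'a" where
  "q_at R p k y = (if k = 0 then y \<ominus>\<^bsub>R\<^esub> \<one>\<^bsub>R\<^esub> else geometric_sum R (y [^]\<^bsub>R\<^esub> (p ^ (k - 1))) (p - 1))"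

lemma (in ring_hom_ring) hom_geometric_sum:
  "y \<in> carrier R \<Longrightarrow> h (geometric_sum R y n) = geometric_sum S (h y) n \<and> geometric_sum R y n \<in> carrier R"
  by (induction n) auto

context cring
begin

lemma geometric_sum_closed [simp]: "y \<in> carrier R \<Longrightarrow> geometric_sum R y n \<in> carrier R"
  by (induction n) auto

lemma q_at_closed [simp]: "y \<in> carrier R \<Longrightarrow> q_at R p k y \<in> carrier R"
  by (simp add: q_at_def)

lemma geometric_sum_telescope:
  "y \<in> carrier R \<Longrightarrow> (y \<ominus> \<one>) \<otimes> geometric_sum R y n = y [^] Suc n \<ominus> \<one>"
proof (induction n)
  case (Suc n)
  have "(y \<ominus> \<one>) \<otimes> geometric_sum R y (Suc n) = (y \<ominus> \<one>) \<otimes> geometric_sum R y n \<otimes> y \<oplus> (y \<ominus> \<one>)"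
    using Suc.prems by (simp add: r_distr m_assoc)
  also have "\<dots> = (y [^] Suc n \<ominus> \<one>) \<otimes> y \<oplus> (y \<ominus> \<one>)" using Suc by simp
  also have "\<dots> = y [^] Suc (Suc n) \<ominus> \<one>"
    using Suc.prems by (simp add: minus_eq l_distr l_minus a_assoc r_neg1 r_neg2 l_neg r_neg)
  finally show ?case .
qed (simp)

lemma geometric_sum_finsum:
  "y \<in> carrier R \<Longrightarrow> (\<Oplus>i\<in>{..n}. y [^] i) = geometric_sum R y n"
proof (induction n)
  case (Suc n)
  have "(\<Oplus>i\<in>{..Suc n}. y [^] i) = (\<Oplus>i\<in>{..n}. y [^] i \<otimes> y) \<oplus> \<one>"
    using Suc.prems by (subst finsum_Suc2) auto
  then show ?case using Suc by (simp add: finsum_ldistr[symmetric])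
qed simp

lemma q_at_telescope:
  assumes y: "y \<in> carrier R" and p: "p > 0"
  shows "(y [^] (p ^ k) \<ominus> \<one>) \<otimes> q_at R p (Suc k) y = y [^] (p ^ Suc k) \<ominus> \<one>"
  using geometric_sum_telescope[of "y [^] (p ^ k)" "p - 1"] y p
  by (simp add: q_at_def nat_pow_pow mult.commute)

text \<open>
  Modulo \<open>y - 1\<close> every power of \<open>y\<close> is 1.
\<close>

lemma geometric_sum_congruent:
  assumes y: "y \<in> carrier R"
  shows "\<exists>h\<in>carrier R. geometric_sum R y n = [Suc n] \<cdot> \<one> \<oplus> (y \<ominus> \<one>) \<otimes> h"
proof (induction n)
  case 0
  show ?case using y by (intro bexI[of _ \<zero>]) auto
next
  case (Suc n)
  then obtain h where h [simp]: "h \<in> carrier R"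
    and e: "geometric_sum R y n = [Suc n] \<cdot> \<one> \<oplus> (y \<ominus> \<one>) \<otimes> h" by blast
  have [simp]: "[Suc n] \<cdot> \<one> \<in> carrier R" by (rule add.nat_pow_closed) simp
  have "geometric_sum R y (Suc n) = [Suc (Suc n)] \<cdot> \<one> \<oplus> (y \<ominus> \<one>) \<otimes> ([Suc n] \<cdot> \<one> \<oplus> h \<otimes> y)"
  proof -
    define c where "c = [Suc n] \<cdot> \<one>"
    define w where "w = y \<ominus> \<one>"
    have [simp]: "c \<in> carrier R" "w \<in> carrier R" using y by (simp_all add: c_def w_def)
    have y': "y = w \<oplus> \<one>" using y by (simp add: w_def minus_eq a_assoc l_neg)
    have "(c \<oplus> w \<otimes> h) \<otimes> y \<oplus> \<one> = (c \<oplus> \<one>) \<oplus> w \<otimes> (c \<oplus> h \<otimes> y)"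
      unfolding y' by (simp add: l_distr r_distr a_ac m_ac)
    moreover have "[Suc (Suc n)] \<cdot> \<one> = c \<oplus> \<one>" by (simp add: c_def)
    ultimately show ?thesis unfolding geometric_sum.simps e c_def w_def by simp
  qed
  then show ?case using y by (intro bexI[of _ "[Suc n] \<cdot> \<one> \<oplus> h \<otimes> y"]) auto
qed

text \<open>
  As \<open>y - 1\<close> divides \<open>y ^ (p ^ k) - 1\<close>, the previous congruence also holds modulo \<open>y - 1\<close>. So \<open>p\<close> is
  a multiple of \<open>y - 1\<close> modulo \<open>q\<^sub>k(y)\<close>; this expresses that \<open>p\<close> ramifies.
\<close>

lemma q_at_congruent:
  assumes y: "y \<in> carrier R" and p: "p > 0"
  shows "\<exists>h\<in>carrier R. q_at R p (Suc k) y = [p] \<cdot> \<one> \<oplus> (y \<ominus> \<one>) \<otimes> h"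
proof -
  obtain h where h: "h \<in> carrier R"
    "q_at R p (Suc k) y = [p] \<cdot> \<one> \<oplus> (y [^] (p ^ k) \<ominus> \<one>) \<otimes> h"
    using geometric_sum_congruent[of "y [^] (p ^ k)" "p - 1"] y p by (auto simp: q_at_def)
  have "y [^] (p ^ k) \<ominus> \<one> = (y \<ominus> \<one>) \<otimes> geometric_sum R y (p ^ k - 1)"
    using geometric_sum_telescope[of y "p ^ k - 1"] y p by simp
  then show ?thesis using h y
    by (intro bexI[of _ "geometric_sum R y (p ^ k - 1) \<otimes> h"]) (simp_all add: m_assoc)
qed

lemma q_at_one_power:
  assumes y: "y \<in> carrier R" and p: "p > 0" and "y [^] (p ^ k) = \<one>"
  shows "q_at R p (Suc k) y = [p] \<cdot> \<one>"
proof -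
  have "geometric_sum R \<one> n = [Suc n] \<cdot> \<one>" for n
    by (induction n) auto
  moreover obtain m where "p = Suc m" using p by (cases p) auto
  ultimately show ?thesis using assms(3) by (simp add: q_at_def)
qed

end

section \<open>The \<open>p\<close>-adic integers\<close>

locale padic =
  fixes p :: nat
  assumes prime: "Factorial_Ring.prime p"
begin

lemma p_gt_1: "p > 1" using prime prime_gt_1_nat by blast

lemma ppow_pos: "0 < int p ^ n" using p_gt_1 by simp

lemma Zp_simps:
  "x \<otimes>\<^bsub>Zp p\<^esub> y = (\<lambda>n. (x n * y n) mod int p ^ n)"
  "x \<oplus>\<^bsub>Zp p\<^esub> y = (\<lambda>n. (x n + y n) mod int p ^ n)"
  "\<one>\<^bsub>Zp p\<^esub> = (\<lambda>n. 1 mod int p ^ n)"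
  "\<zero>\<^bsub>Zp p\<^esub> = (\<lambda>n. 0)"
  by (simp_all add: Zp_def)

lemma Zp_carrier:
  "x \<in> carrier (Zp p) \<longleftrightarrow> (\<forall>n. x n \<in> {0..<int p ^ n} \<and> x (Suc n) mod int p ^ n = x n)"
  by (simp add: Zp_def)

lemma Zp_carrierI:
  assumes "\<And>n. x n = z n mod int p ^ n" "\<And>n. z (Suc n) mod int p ^ n = z n mod int p ^ n"
  shows "x \<in> carrier (Zp p)"
  using assms unfolding Zp_carrier
  by (auto simp: mod_mod_cancel pos_mod_sign[OF ppow_pos] pos_mod_bound[OF ppow_pos])

lemma Zp_mod: "x \<in> carrier (Zp p) \<Longrightarrow> x n mod int p ^ n = x n"
  unfolding Zp_carrier by (metis atLeastLessThan_iff mod_pos_pos_trivial)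

lemma Zp_Suc_mod: "x \<in> carrier (Zp p) \<Longrightarrow> x (Suc n) mod int p ^ n = x n"
  unfolding Zp_carrier by blast

lemma Zp_mod_p: "x \<in> carrier (Zp p) \<Longrightarrow> x (Suc n) mod int p = x 1"
proof (induction n)
  case 0
  then show ?case using Zp_mod[of x 1] by simp
next
  case (Suc n)
  have "x (Suc (Suc n)) mod int p ^ Suc n mod int p = x (Suc n) mod int p"
    using Zp_Suc_mod[OF Suc.prems, of "Suc n"] by simp
  then show ?case using Suc by (simp add: mod_mod_cancel)
qed

lemma Zp_cring: "cring (Zp p)"
proof -
  have mult_closed: "x \<otimes>\<^bsub>Zp p\<^esub> y \<in> carrier (Zp p)"
    if "x \<in> carrier (Zp p)" "y \<in> carrier (Zp p)" for x y
    unfolding Zp_simps using that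
    by (intro Zp_carrierI[of _ "\<lambda>n. x n * y n"]) (auto intro: mod_mult_cong simp: Zp_Suc_mod Zp_mod)
  have add_closed: "x \<oplus>\<^bsub>Zp p\<^esub> y \<in> carrier (Zp p)"
    if "x \<in> carrier (Zp p)" "y \<in> carrier (Zp p)" for x y
    unfolding Zp_simps using that
    by (intro Zp_carrierI[of _ "\<lambda>n. x n + y n"]) (auto intro: mod_add_cong simp: Zp_Suc_mod Zp_mod)
  have neg_closed: "(\<lambda>n. (- x n) mod int p ^ n) \<in> carrier (Zp p)" if "x \<in> carrier (Zp p)" for x
    using that
    by (intro Zp_carrierI[of _ "\<lambda>n. - x n"]) (auto intro: mod_minus_cong simp: Zp_Suc_mod Zp_mod)
  have one_closed: "\<one>\<^bsub>Zp p\<^esub> \<in> carrier (Zp p)"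
    unfolding Zp_simps by (intro Zp_carrierI[of _ "\<lambda>n. 1"]) auto
  have zero_closed: "\<zero>\<^bsub>Zp p\<^esub> \<in> carrier (Zp p)"
    unfolding Zp_simps by (intro Zp_carrierI[of _ "\<lambda>n. 0"]) auto
  show ?thesis
  proof (intro cringI abelian_groupI comm_monoidI)
    fix x assume "x \<in> carrier (Zp p)"
    then show "\<exists>y\<in>carrier (Zp p). y \<oplus>\<^bsub>Zp p\<^esub> x = \<zero>\<^bsub>Zp p\<^esub>"
      by (intro bexI[OF _ neg_closed]) (auto simp: Zp_simps fun_eq_iff mod_simps)
  qed (auto simp: mult_closed add_closed one_closed zero_closed,
       auto simp: Zp_simps fun_eq_iff mod_simps algebra_simps Zp_mod)
qed

sublocale Zp: cring "Zp p" by (rule Zp_cring)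

lemma Zp_of_nat: "[k] \<cdot>\<^bsub>Zp p\<^esub> \<one>\<^bsub>Zp p\<^esub> = (\<lambda>n. int k mod int p ^ n)"
  by (induction k) (auto simp: Zp_simps fun_eq_iff mod_simps ac_simps)

text \<open>
  The \<open>p\<close>-adic integers are a local ring with maximal ideal \<open>(p)\<close>. If \<open>x\<close> is zero modulo \<open>p\<close>, the
  digits are shifted by one place; otherwise the inverses modulo all \<open>p ^ n\<close> exist, and they are
  compatible because inverses are unique.
\<close>

lemma Zp_cases:
  assumes x: "x \<in> carrier (Zp p)"
  obtains (unit) y where "y \<in> carrier (Zp p)" "x \<otimes>\<^bsub>Zp p\<^esub> y = \<one>\<^bsub>Zp p\<^esub>"
  | (multiple) y where "y \<in> carrier (Zp p)" "x = [p] \<cdot>\<^bsub>Zp p\<^esub> \<one>\<^bsub>Zp p\<^esub> \<otimes>\<^bsub>Zp p\<^esub> y"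
proof (cases "x 1 = 0")
  case True
  \<comment> \<open>Division by \<open>p\<close> loses one digit, hence the shifted index.\<close>
  define y where "y n = x (Suc n) div int p" for n
  have dvd: "int p dvd x (Suc n)" for n
    using Zp_mod_p[OF x, of n] True by auto
  have px: "int p * y n = x (Suc n)" for n using dvd by (simp add: y_def)
  have pp: "int p > 0" using p_gt_1 by simp
  have "y \<in> carrier (Zp p)"
    unfolding Zp_carrier
  proof (intro allI conjI)
    fix n
    have "0 \<le> int p * y n" "int p * y n < int p * int p ^ n"
      using x unfolding px Zp_carrier by (metis atLeastLessThan_iff power_Suc)+
    then show "y n \<in> {0..<int p ^ n}" using pp
      by (metis atLeastLessThan_iff mult_less_cancel_left_pos zero_le_mult_iff less_le_not_le)
    have "(int p * y (Suc n)) mod (int p * int p ^ n) = int p * y n"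
      unfolding px using Zp_Suc_mod[OF x, of "Suc n"] by simp
    then show "y (Suc n) mod int p ^ n = y n"
      using pp by (simp add: mult_mod_right[symmetric])
  qed
  moreover have "x = [p] \<cdot>\<^bsub>Zp p\<^esub> \<one>\<^bsub>Zp p\<^esub> \<otimes>\<^bsub>Zp p\<^esub> y"
    unfolding Zp_of_nat Zp_simps(1) using Zp_Suc_mod[OF x]
    by (simp add: fun_eq_iff mod_simps px)
  ultimately show ?thesis by (rule multiple)
next
  case False
  have "\<exists>y. y \<in> {0..<int p ^ n} \<and> [x n * y = 1] (mod int p ^ n)" for n
  proof -
    have "coprime (x n) (int p ^ n)"
    proof (cases n)
      case (Suc m)
      have "\<not> int p dvd x n"
        using Zp_mod_p[OF x, of m] False Suc by (auto simp: dvd_eq_mod_eq_0)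
      then have "coprime (int p) (x n)"
        using prime by (intro prime_imp_coprime) auto
      then show ?thesis by (simp add: ac_simps)
    qed simp
    then obtain y where "[x n * y = 1] (mod int p ^ n)" using cong_solve_coprime_int by blast
    then show ?thesis
      by (intro exI[of _ "y mod int p ^ n"]) (auto simp: cong_def mod_simps pos_mod_sign[OF ppow_pos] pos_mod_bound[OF ppow_pos])
  qed
  then obtain y where y: "\<And>n. y n \<in> {0..<int p ^ n}" "\<And>n. [x n * y n = 1] (mod int p ^ n)"
    by metis
  have "y (Suc n) mod int p ^ n = y n" for n
  proof -
    have "[x (Suc n) * y (Suc n) = 1] (mod int p ^ n)"
      using y(2)[of "Suc n"] by (rule cong_dvd_modulus) simp
    moreover have "[x (Suc n) * y (Suc n) = x n * y (Suc n)] (mod int p ^ n)"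
      using Zp_Suc_mod[OF x, of n] Zp_mod[OF x, of n] by (intro cong_mult cong_refl) (simp add: cong_def)
    ultimately have 1: "[x n * y (Suc n) = 1] (mod int p ^ n)"
      using cong_sym cong_trans by blast
    have "[y (Suc n) = y n * (x n * y (Suc n))] (mod int p ^ n)"
      using cong_mult[OF cong_refl y(2)[of n], of "y (Suc n)"] by (simp add: ac_simps cong_sym)
    also have "[y n * (x n * y (Suc n)) = y n * 1] (mod int p ^ n)"
      by (intro cong_mult cong_refl 1)
    finally show ?thesis using y(1)[of n] by (simp add: cong_def)
  qed
  then have "y \<in> carrier (Zp p)" using y(1) unfolding Zp_carrier by blast
  moreover have "x \<otimes>\<^bsub>Zp p\<^esub> y = \<one>\<^bsub>Zp p\<^esub>" using y(2) by (simp add: Zp_simps cong_def fun_eq_iff)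
  ultimately show ?thesis by (rule unit)
qed

lemma rnorm_Zp_nonneg: "0 \<le> rnorm (Zp p) x" and rnorm_Zp_le_1: "rnorm (Zp p) x \<le> 1"
  using p_gt_1 by (auto simp: Zp_def intro!: power_le_one)

lemma rnorm_Zp_zero: "rnorm (Zp p) \<zero>\<^bsub>Zp p\<^esub> = 0"
  by (simp add: Zp_def)

lemma rnorm_Zp_p: "rnorm (Zp p) ([p] \<cdot>\<^bsub>Zp p\<^esub> \<one>\<^bsub>Zp p\<^esub>) = 1 / real p"
proof -
  have p2: "int p mod int p ^ Suc 1 = int p" using p_gt_1 by simp
  have "(LEAST n. int p mod int p ^ Suc n \<noteq> 0) = 1"
  proof (rule Least_equality)
    show "int p mod int p ^ Suc 1 \<noteq> 0" using p2 p_gt_1 by simp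
    fix n assume "int p mod int p ^ Suc n \<noteq> 0"
    then show "1 \<le> n" by (cases n) auto
  qed
  moreover have "(\<lambda>n. int p mod int p ^ n) \<noteq> (\<lambda>n. 0)"
    using p2 p_gt_1 by (metis of_nat_0_less_iff less_trans zero_less_one less_irrefl)
  ultimately show ?thesis unfolding Zp_of_nat by (simp add: Zp_def)
qed

lemma residue_ring_field: "field (residue_ring (int p))"
proof -
  interpret residues_prime p "residue_ring (int p)"
    by (unfold_locales) (use prime in auto)
  show ?thesis by (rule field_axioms)
qed

lemma Zp_residue_hom: "Zp_residue \<in> ring_hom (Zp p) (residue_ring (int p))"
proof (rule ring_hom_memI)
  fix x assume "x \<in> carrier (Zp p)"
  then have "x 1 \<in> {0..<int p ^ 1}" unfolding Zp_carrier by blast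
  then show "Zp_residue x \<in> carrier (residue_ring (int p))"
    by (simp add: Zp_residue_def residue_ring_def)
qed (use p_gt_1 in \<open>auto simp: Zp_residue_def residue_ring_def Zp_simps\<close>)

end

section \<open>Seminorms bounded by one\<close>

text \<open>
  The bound by 1 is what remains of contractivity once the norms of all elements are at most 1.
\<close>

locale bounded_seminorm = seminormed_cring +
  assumes le_one: "a \<in> carrier R \<Longrightarrow> \<nu> a \<le> 1"
    and one_one: "\<nu> \<one> = 1"
begin

lemma add_le_max: "\<lbrakk>a \<in> carrier R; b \<in> carrier R\<rbrakk> \<Longrightarrow> \<nu> (a \<oplus> b) \<le> max (\<nu> a) (\<nu> b)"
  by (rule ultrametric[of "carrier R"]) (auto simp: le_one)

lemma unit_one:
  assumes "e \<in> carrier R" "e' \<in> carrier R" "e \<otimes> e' = \<one>"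
  shows "\<nu> e = 1"
proof -
  have "\<nu> e * \<nu> e' = 1" using mult[of e e'] assms one_one by simp
  moreover have "\<nu> e * \<nu> e' \<le> \<nu> e * 1" by (intro mult_left_mono le_one nonneg assms)
  ultimately show ?thesis using le_one[OF assms(1)] by simp
qed

lemma add_small:
  assumes "e \<in> carrier R" "y \<in> carrier R" "\<nu> e = 1" "\<nu> y < 1"
  shows "\<nu> (e \<oplus> y) = 1"
proof -
  have "\<nu> e \<le> max (\<nu> (e \<oplus> y)) (\<nu> (\<ominus> y))"
    using add_le_max[of "e \<oplus> y" "\<ominus> y"] assms by (simp add: a_assoc r_neg)
  then show ?thesis using assms le_one[of "e \<oplus> y"] by (simp add: neg)
qed

lemma mult_small:
  assumes "a \<in> carrier R" "b \<in> carrier R" "\<nu> a < 1"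
  shows "\<nu> (a \<otimes> b) < 1"
  using mult_right_le_one_le[of "\<nu> a" "\<nu> b"] assms nonneg le_one by (fastforce simp: mult)

end

text \<open>
  The abstract form of the group ring, with \<open>P = p\<close> and \<open>x = u - 1\<close>: the elements outside
  the ideal \<open>(P, x)\<close> are congruent to units modulo \<open>x\<close>, so this ideal is maximal if it is proper; and
  \<open>x\<close> is nilpotent modulo \<open>P\<close>.
\<close>

locale descent_ring = cring R for R (structure) +
  fixes P x :: 'a
  assumes P [simp]: "P \<in> carrier R" and x [simp]: "x \<in> carrier R"
    and cases_mod: "f \<in> carrier R \<Longrightarrow>
      (\<exists>e\<in>carrier R. \<exists>e'\<in>carrier R. \<exists>g\<in>carrier R. e \<otimes> e' = \<one> \<and> f = e \<oplus> x \<otimes> g) \<or>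
      (\<exists>a\<in>carrier R. \<exists>g\<in>carrier R. f = P \<otimes> a \<oplus> x \<otimes> g)"
    and nilpotent: "\<exists>M::nat. \<exists>s\<in>carrier R. x [^] M = P \<otimes> s"
begin

lemma x_small:
  assumes "bounded_seminorm R \<nu>" "\<nu> P < 1"
  shows "\<nu> x < 1" "\<nu> P = 0 \<Longrightarrow> \<nu> x = 0"
proof -
  interpret bounded_seminorm R \<nu> by fact
  obtain M :: nat and s where s: "s \<in> carrier R" "x [^] M = P \<otimes> s" using nilpotent by blast
  then have e: "\<nu> x ^ M = \<nu> P * \<nu> s" using pow[OF one_one x, of M] mult[OF P] by simp
  have "\<nu> (P \<otimes> s) < 1" using mult_small[OF P] s assms by simp
  then show "\<nu> x < 1" using e mult[OF P s(1)] one_le_power[of "\<nu> x" M] by (metis not_le)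
  show "\<nu> x = 0" if "\<nu> P = 0" using e that by simp
qed

lemma unit_case:
  assumes "bounded_seminorm R \<nu>" "\<nu> P < 1"
    and "e \<in> carrier R" "e' \<in> carrier R" "g \<in> carrier R" "e \<otimes> e' = \<one>"
  shows "\<nu> (e \<oplus> x \<otimes> g) = 1"
proof -
  interpret bounded_seminorm R \<nu> by fact
  show ?thesis using assms x_small[OF assms(1,2)] by (intro add_small mult_small unit_one) auto
qed

lemma multiple_case:
  assumes "bounded_seminorm R \<nu>" "\<nu> P < 1" "a \<in> carrier R" "g \<in> carrier R"
  shows "\<nu> (P \<otimes> a \<oplus> x \<otimes> g) < 1" "\<nu> P = 0 \<Longrightarrow> \<nu> (P \<otimes> a \<oplus> x \<otimes> g) = 0"
proof -
  interpret bounded_seminorm R \<nu> by fact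
  have "\<nu> (P \<otimes> a) < 1" "\<nu> (x \<otimes> g) < 1"
    using assms x_small[OF assms(1,2)] mult_small by auto
  then show "\<nu> (P \<otimes> a \<oplus> x \<otimes> g) < 1" using add_le_max[of "P \<otimes> a" "x \<otimes> g"] assms by simp
  show "\<nu> (P \<otimes> a \<oplus> x \<otimes> g) = 0" if "\<nu> P = 0"
    using assms that x_small(2)[OF assms(1,2)] by (simp add: add_null mult)
qed

text \<open>
  Whether an element lies in the maximal ideal is visible to every seminorm that is less than 1 at
  \<open>P\<close>. So a seminorm that vanishes at \<open>P\<close>, and therefore on the whole maximal ideal, can be read off
  from any other one. In particular there is at most one such seminorm.
\<close>

lemma residual_seminorm:
  assumes "bounded_seminorm R \<nu>" "\<nu> P < 1" "bounded_seminorm R \<mu>" "\<mu> P = 0" "f \<in> carrier R"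
  shows "\<mu> f = (if \<nu> f < 1 then 0 else 1)"
  using cases_mod[OF assms(5)]
  using unit_case[OF assms(1,2)] unit_case[OF assms(3)] multiple_case[OF assms(1,2)]
    multiple_case[OF assms(3)] assms(4)
  by fastforce

text \<open>
  Modulo the kernel of \<open>\<nu>\<close>, the maximal ideal is generated by \<open>\<pi>\<close>. The cofactors \<open>h1\<close> and \<open>h2\<close> are
  parameters because the descent below compares two seminorms and has to divide by \<open>\<pi>\<close> in the same
  way for both.
\<close>

definition uniformizes :: "'a \<Rightarrow> 'a \<Rightarrow> 'a \<Rightarrow> ('a \<Rightarrow> real) \<Rightarrow> bool" where
  "uniformizes \<pi> h1 h2 \<nu> \<longleftrightarrow> \<nu> (P \<ominus> \<pi> \<otimes> h1) = 0 \<and> \<nu> (x \<ominus> \<pi> \<otimes> h2) = 0"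

lemma uniformizer_step:
  assumes "bounded_seminorm R \<nu>" "uniformizes \<pi> h1 h2 \<nu>"
    and [simp]: "\<pi> \<in> carrier R" "h1 \<in> carrier R" "h2 \<in> carrier R" "a \<in> carrier R" "g \<in> carrier R"
  shows "\<nu> (P \<otimes> a \<oplus> x \<otimes> g) = \<nu> \<pi> * \<nu> (h1 \<otimes> a \<oplus> h2 \<otimes> g)"
proof -
  interpret bounded_seminorm R \<nu> by fact
  let ?k1 = "P \<ominus> \<pi> \<otimes> h1" and ?k2 = "x \<ominus> \<pi> \<otimes> h2"
  have k: "\<nu> ?k1 = 0" "\<nu> ?k2 = 0" using assms(2) by (auto simp: uniformizes_def)
  have c [simp]: "?k1 \<in> carrier R" "?k2 \<in> carrier R" by auto
  have Px: "P = \<pi> \<otimes> h1 \<oplus> ?k1" "x = \<pi> \<otimes> h2 \<oplus> ?k2"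
    by (auto simp: minus_eq a_comm[of _ "\<ominus> _"] r_neg2)
  have "P \<otimes> a \<oplus> x \<otimes> g = (\<pi> \<otimes> h1 \<oplus> ?k1) \<otimes> a \<oplus> (\<pi> \<otimes> h2 \<oplus> ?k2) \<otimes> g"
    using Px by simp
  also have "\<dots> = \<pi> \<otimes> (h1 \<otimes> a \<oplus> h2 \<otimes> g) \<oplus> (?k1 \<otimes> a \<oplus> ?k2 \<otimes> g)"
    using c by (simp only: l_distr r_distr a_ac m_assoc assms m_closed a_closed)
  finally have "P \<otimes> a \<oplus> x \<otimes> g = \<dots>" .
  moreover have "\<nu> (?k1 \<otimes> a \<oplus> ?k2 \<otimes> g) = 0" by (simp add: add_null mult k)
  ultimately show ?thesis by (simp add: add_null mult)
qed

text \<open>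
  As long as \<open>f\<close> lies in \<open>(P, x)\<close>, a factor \<open>\<pi>\<close> is split off, simultaneously for both seminorms. If this
  stops after \<open>m\<close> steps, the seminorms of \<open>f\<close> are the \<open>m\<close>-th powers of those of \<open>\<pi>\<close>; if it never
  stops, they are smaller than all of these powers and hence zero.
\<close>

lemma parallel_descent:
  assumes \<nu>: "bounded_seminorm R \<nu>" "\<nu> P < 1" "uniformizes \<pi> h1 h2 \<nu>" "\<nu> \<pi> < 1"
    and \<mu>: "bounded_seminorm R \<mu>" "\<mu> P < 1" "uniformizes \<pi> h1 h2 \<mu>" "\<mu> \<pi> < 1"
    and c: "\<pi> \<in> carrier R" "h1 \<in> carrier R" "h2 \<in> carrier R" "f \<in> carrier R"
  shows "(\<exists>m. \<nu> f = \<nu> \<pi> ^ m \<and> \<mu> f = \<mu> \<pi> ^ m) \<or> \<nu> f = 0 \<and> \<mu> f = 0"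
proof (rule ccontr)
  interpret N: bounded_seminorm R \<nu> by fact
  interpret M: bounded_seminorm R \<mu> by fact
  assume neg: "\<not> ?thesis"
  have "\<exists>h\<in>carrier R. \<nu> f = \<nu> \<pi> ^ n * \<nu> h \<and> \<mu> f = \<mu> \<pi> ^ n * \<mu> h" for n
  proof (induction n)
    case 0
    then show ?case using c by auto
  next
    case (Suc n)
    then obtain h where h: "h \<in> carrier R" "\<nu> f = \<nu> \<pi> ^ n * \<nu> h" "\<mu> f = \<mu> \<pi> ^ n * \<mu> h" by blast
    from cases_mod[OF h(1)] show ?case
    proof (elim disjE bexE conjE)
      fix e e' g assume "e \<in> carrier R" "e' \<in> carrier R" "g \<in> carrier R" "e \<otimes> e' = \<one>"
        and "h = e \<oplus> x \<otimes> g"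
      then have "\<nu> h = 1" "\<mu> h = 1" using unit_case[OF \<nu>(1,2)] unit_case[OF \<mu>(1,2)] by auto
      then show ?case using h neg by auto
    next
      fix a g assume ag: "a \<in> carrier R" "g \<in> carrier R" "h = P \<otimes> a \<oplus> x \<otimes> g"
      show ?case
        using uniformizer_step[OF \<nu>(1,3) c(1-3) ag(1,2)] uniformizer_step[OF \<mu>(1,3) c(1-3) ag(1,2)]
          ag h c by (intro bexI[of _ "h1 \<otimes> a \<oplus> h2 \<otimes> g"]) auto
    qed
  qed
  then have le: "\<nu> f \<le> \<nu> \<pi> ^ n" "\<mu> f \<le> \<mu> \<pi> ^ n" for n
    using N.le_one M.le_one N.nonneg M.nonneg c
    by (metis mult.right_neutral mult_left_mono zero_le_power)+
  have "(\<lambda>n. \<nu> \<pi> ^ n) \<longlonglongrightarrow> 0" "(\<lambda>n. \<mu> \<pi> ^ n) \<longlonglongrightarrow> 0"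
    using \<nu>(4) \<mu>(4) N.nonneg M.nonneg c by (auto intro!: LIMSEQ_realpow_zero)
  then have "\<nu> f \<le> 0" "\<mu> f \<le> 0"
    using le by (auto intro: LIMSEQ_le_const)
  then have "\<nu> f = 0 \<and> \<mu> f = 0" using N.nonneg[OF c(4)] M.nonneg[OF c(4)] by simp
  then show False using neg by simp
qed

text \<open>
  The descent for \<open>P\<close> itself yields the same exponent \<open>m \<noteq> 0\<close> for both seminorms, and taking \<open>m\<close>-th
  roots turns the assumption on \<open>P\<close> into \<open>\<nu> \<pi> = \<mu> \<pi> powr \<omega>\<close>; the descent for \<open>f\<close> transports this to \<open>f\<close>.
\<close>

lemma seminorm_determined:
  assumes \<nu>: "bounded_seminorm R \<nu>" "uniformizes \<pi> h1 h2 \<nu>"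
    and \<mu>: "bounded_seminorm R \<mu>" "uniformizes \<pi> h1 h2 \<mu>"
    and P_less: "0 < \<mu> P" "\<mu> P < 1" and "0 < \<omega>" and eq: "\<nu> P = \<mu> P powr \<omega>"
    and \<pi>: "\<pi> \<in> {P, x}" and c: "h1 \<in> carrier R" "h2 \<in> carrier R" "f \<in> carrier R"
  shows "\<nu> f = \<mu> f powr \<omega>"
proof -
  interpret N: bounded_seminorm R \<nu> by fact
  interpret M: bounded_seminorm R \<mu> by fact
  have \<nu>P: "\<nu> P < 1" "\<nu> P > 0" unfolding eq using P_less \<open>0 < \<omega>\<close> powr_less_mono2[of \<omega> "\<mu> P" 1] by auto
  have \<pi>_less: "\<nu> \<pi> < 1" "\<mu> \<pi> < 1"
    using \<pi> x_small[OF \<nu>(1) \<nu>P(1)] x_small[OF \<mu>(1) P_less(2)] \<nu>P P_less by auto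
  have \<pi>c: "\<pi> \<in> carrier R" using \<pi> by auto
  have powr_pow: "(\<mu> \<pi> ^ m) powr \<omega> = (\<mu> \<pi> powr \<omega>) ^ m" for m
    using M.nonneg[OF \<pi>c] by (induction m) (auto simp: powr_mult)
  note desc = parallel_descent[OF \<nu>(1) \<nu>P(1) \<nu>(2) \<pi>_less(1) \<mu>(1) P_less(2) \<mu>(2) \<pi>_less(2) \<pi>c c(1,2)]
  obtain m where m: "\<nu> P = \<nu> \<pi> ^ m" "\<mu> P = \<mu> \<pi> ^ m"
    using desc[OF P] P_less by auto
  have "m \<noteq> 0" using m P_less by (metis power_0 less_irrefl)
  moreover have "\<nu> \<pi> ^ m = (\<mu> \<pi> powr \<omega>) ^ m" using eq m powr_pow by simp
  ultimately have \<pi>_eq: "\<nu> \<pi> = \<mu> \<pi> powr \<omega>"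
    using N.nonneg[OF \<pi>c] by (metis power_eq_imp_eq_base powr_ge_zero neq0_conv)
  show ?thesis using desc[OF c(3)] powr_pow \<pi>_eq by auto
qed

end

section \<open>Group rings\<close>

lemma (in abelian_monoid) finsum_swap:
  assumes "finite A" "finite B" and f: "\<And>i j. \<lbrakk>i \<in> A; j \<in> B\<rbrakk> \<Longrightarrow> f i j \<in> carrier G"
  shows "(\<Oplus>i\<in>A. \<Oplus>j\<in>B. f i j) = (\<Oplus>j\<in>B. \<Oplus>i\<in>A. f i j)"
  using assms(1) f
proof (induction A)
  case empty
  then show ?case by (simp add: finsum_zero)
next
  case (insert i A)
  have "(\<Oplus>i\<in>insert i A. \<Oplus>j\<in>B. f i j) = (\<Oplus>j\<in>B. f i j) \<oplus> (\<Oplus>j\<in>B. \<Oplus>i\<in>A. f i j)"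
    using insert by (subst finsum_insert) auto
  also have "\<dots> = (\<Oplus>j\<in>B. f i j \<oplus> (\<Oplus>i\<in>A. f i j))"
    using insert.prems by (intro finsum_addf[symmetric]) auto
  also have "\<dots> = (\<Oplus>j\<in>B. \<Oplus>i\<in>insert i A. f i j)"
    using insert by (intro finsum_cong') auto
  finally show ?case .
qed

locale finite_group_ring = R?: cring R + G?: comm_group G
  for R :: "('r, 'm) normed_ring_scheme" and G :: "('g, 'n) monoid_scheme" +
  assumes fin: "finite (carrier G)"
begin

abbreviation S where "S \<equiv> group_ring R G"

definition single :: "'g \<Rightarrow> 'r \<Rightarrow> 'g \<Rightarrow> 'r" where
  "single h c = (\<lambda>g\<in>carrier G. if g = h then c else \<zero>\<^bsub>R\<^esub>)"

lemma carrier_S: "carrier S = carrier G \<rightarrow>\<^sub>E carrier R"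
  by (simp add: group_ring_def)

lemma S_closed [simp]: "\<lbrakk>a \<in> carrier S; g \<in> carrier G\<rbrakk> \<Longrightarrow> a g \<in> carrier R"
  by (auto simp: carrier_S)

lemma S_eqI:
  "\<lbrakk>a \<in> carrier S; b \<in> carrier S; \<And>g. g \<in> carrier G \<Longrightarrow> a g = b g\<rbrakk> \<Longrightarrow> a = b"
  unfolding carrier_S by (rule PiE_ext)

lemma mult_at: "g \<in> carrier G \<Longrightarrow>
    (a \<otimes>\<^bsub>S\<^esub> b) g = (\<Oplus>\<^bsub>R\<^esub>h\<in>carrier G. a h \<otimes>\<^bsub>R\<^esub> b (inv\<^bsub>G\<^esub> h \<otimes>\<^bsub>G\<^esub> g))"
  and add_at: "g \<in> carrier G \<Longrightarrow> (a \<oplus>\<^bsub>S\<^esub> b) g = a g \<oplus>\<^bsub>R\<^esub> b g"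
  and zero_at: "g \<in> carrier G \<Longrightarrow> \<zero>\<^bsub>S\<^esub> g = \<zero>\<^bsub>R\<^esub>"
  and single_at: "g \<in> carrier G \<Longrightarrow> single h c g = (if g = h then c else \<zero>\<^bsub>R\<^esub>)"
  by (simp_all add: group_ring_def single_def)

lemma mult_S_closed: "\<lbrakk>a \<in> carrier S; b \<in> carrier S\<rbrakk> \<Longrightarrow> a \<otimes>\<^bsub>S\<^esub> b \<in> carrier S"
  by (auto simp: group_ring_def intro!: R.finsum_closed R.m_closed)

lemma add_S_closed: "\<lbrakk>a \<in> carrier S; b \<in> carrier S\<rbrakk> \<Longrightarrow> a \<oplus>\<^bsub>S\<^esub> b \<in> carrier S"
  and one_S_closed: "\<one>\<^bsub>S\<^esub> \<in> carrier S" and zero_S_closed: "\<zero>\<^bsub>S\<^esub> \<in> carrier S"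
  by (auto simp: group_ring_def)

lemma single_closed [simp]: "c \<in> carrier R \<Longrightarrow> single h c \<in> carrier S"
  by (auto simp: carrier_S single_def)

lemma finsum_translate:
  fixes T :: "('t, 'k) ring_scheme"
  assumes "cring T" and f: "f \<in> carrier G \<rightarrow> carrier T" and k: "k \<in> carrier G"
  shows "(\<Oplus>\<^bsub>T\<^esub>h\<in>carrier G. f (k \<otimes>\<^bsub>G\<^esub> h)) = (\<Oplus>\<^bsub>T\<^esub>h\<in>carrier G. f h)"
proof -
  interpret T: cring T by fact
  show ?thesis
    using T.finsum_reindex[of f "\<lambda>h. k \<otimes>\<^bsub>G\<^esub> h" "carrier G"] f G.inj_on_cmult[OF k] G.surj_const_mult[OF k]
    by simp
qed

lemma finsum_reflect:
  assumes f: "f \<in> carrier G \<rightarrow> carrier R" and g: "g \<in> carrier G"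
  shows "(\<Oplus>\<^bsub>R\<^esub>h\<in>carrier G. f (inv\<^bsub>G\<^esub> h \<otimes>\<^bsub>G\<^esub> g)) = (\<Oplus>\<^bsub>R\<^esub>h\<in>carrier G. f h)"
proof -
  have eq: "inv\<^bsub>G\<^esub> (inv\<^bsub>G\<^esub> h \<otimes>\<^bsub>G\<^esub> g) \<otimes>\<^bsub>G\<^esub> g = h" if "h \<in> carrier G" for h
    using that g by (simp add: G.inv_mult G.m_assoc)
  have inj: "inj_on (\<lambda>h. inv\<^bsub>G\<^esub> h \<otimes>\<^bsub>G\<^esub> g) (carrier G)"
    by (rule inj_on_inverseI[of _ "\<lambda>h. inv\<^bsub>G\<^esub> h \<otimes>\<^bsub>G\<^esub> g"]) (rule eq)
  have "(\<lambda>h. inv\<^bsub>G\<^esub> h \<otimes>\<^bsub>G\<^esub> g) ` carrier G = carrier G"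
  proof (intro equalityI subsetI)
    fix h assume h: "h \<in> carrier G"
    then show "h \<in> (\<lambda>h. inv\<^bsub>G\<^esub> h \<otimes>\<^bsub>G\<^esub> g) ` carrier G"
      using g eq[OF h, symmetric] by (intro image_eqI[of _ _ "inv\<^bsub>G\<^esub> h \<otimes>\<^bsub>G\<^esub> g"]) auto
  qed (use g in auto)
  then show ?thesis using R.finsum_reindex[OF _ inj] f by simp
qed

lemma single_mult_at:
  assumes "h \<in> carrier G" "g \<in> carrier G" "c \<in> carrier R" "b \<in> carrier S"
  shows "(single h c \<otimes>\<^bsub>S\<^esub> b) g = c \<otimes>\<^bsub>R\<^esub> b (inv\<^bsub>G\<^esub> h \<otimes>\<^bsub>G\<^esub> g)"
proof -
  have "(single h c \<otimes>\<^bsub>S\<^esub> b) g =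
      (\<Oplus>\<^bsub>R\<^esub>k\<in>carrier G. if h = k then c \<otimes>\<^bsub>R\<^esub> b (inv\<^bsub>G\<^esub> k \<otimes>\<^bsub>G\<^esub> g) else \<zero>\<^bsub>R\<^esub>)"
    unfolding mult_at[OF assms(2)] using assms by (intro R.finsum_cong') (auto simp: single_at)
  also have "\<dots> = c \<otimes>\<^bsub>R\<^esub> b (inv\<^bsub>G\<^esub> h \<otimes>\<^bsub>G\<^esub> g)"
    using assms fin by (intro R.finsum_singleton) auto
  finally show ?thesis .
qed

lemma one_S: "\<one>\<^bsub>S\<^esub> = single \<one>\<^bsub>G\<^esub> \<one>\<^bsub>R\<^esub>"
  by (simp add: group_ring_def single_def)

lemma group_ring_cring: "cring S"
proof (intro cringI abelian_groupI comm_monoidI)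
  fix a assume a: "a \<in> carrier S"
  show "\<exists>b\<in>carrier S. b \<oplus>\<^bsub>S\<^esub> a = \<zero>\<^bsub>S\<^esub>"
  proof (rule bexI)
    show c: "(\<lambda>g\<in>carrier G. \<ominus>\<^bsub>R\<^esub> a g) \<in> carrier S" using a by (auto simp: carrier_S)
    show "(\<lambda>g\<in>carrier G. \<ominus>\<^bsub>R\<^esub> a g) \<oplus>\<^bsub>S\<^esub> a = \<zero>\<^bsub>S\<^esub>"
      using a c by (intro S_eqI) (auto simp: add_S_closed zero_S_closed add_at zero_at R.l_neg)
  qed
  show "\<one>\<^bsub>S\<^esub> \<otimes>\<^bsub>S\<^esub> a = a"
    unfolding one_S using a
    by (intro S_eqI) (auto simp: mult_S_closed single_mult_at)
  fix b assume b: "b \<in> carrier S"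
  show "a \<otimes>\<^bsub>S\<^esub> b = b \<otimes>\<^bsub>S\<^esub> a"
  proof (rule S_eqI)
    fix g assume g: "g \<in> carrier G"
    let ?f = "\<lambda>h. b h \<otimes>\<^bsub>R\<^esub> a (inv\<^bsub>G\<^esub> h \<otimes>\<^bsub>G\<^esub> g)"
    have "(\<Oplus>\<^bsub>R\<^esub>h\<in>carrier G. a h \<otimes>\<^bsub>R\<^esub> b (inv\<^bsub>G\<^esub> h \<otimes>\<^bsub>G\<^esub> g)) =
        (\<Oplus>\<^bsub>R\<^esub>h\<in>carrier G. ?f (inv\<^bsub>G\<^esub> h \<otimes>\<^bsub>G\<^esub> g))"
      using a b g by (intro R.finsum_cong') (auto simp: G.inv_mult G.m_assoc R.m_comm)
    also have "\<dots> = (\<Oplus>\<^bsub>R\<^esub>h\<in>carrier G. ?f h)"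
      using a b g by (intro finsum_reflect) auto
    finally show "(a \<otimes>\<^bsub>S\<^esub> b) g = (b \<otimes>\<^bsub>S\<^esub> a) g" using g by (simp add: mult_at)
  qed (auto simp: a b mult_S_closed)
  fix c assume c: "c \<in> carrier S"
  show "a \<otimes>\<^bsub>S\<^esub> b \<otimes>\<^bsub>S\<^esub> c = a \<otimes>\<^bsub>S\<^esub> (b \<otimes>\<^bsub>S\<^esub> c)"
  proof (rule S_eqI)
    fix g assume g: "g \<in> carrier G"
    let ?t = "\<lambda>k h. a k \<otimes>\<^bsub>R\<^esub> (b (inv\<^bsub>G\<^esub> k \<otimes>\<^bsub>G\<^esub> h) \<otimes>\<^bsub>R\<^esub> c (inv\<^bsub>G\<^esub> h \<otimes>\<^bsub>G\<^esub> g))"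
    have "(a \<otimes>\<^bsub>S\<^esub> b \<otimes>\<^bsub>S\<^esub> c) g = (\<Oplus>\<^bsub>R\<^esub>h\<in>carrier G.
        (\<Oplus>\<^bsub>R\<^esub>k\<in>carrier G. a k \<otimes>\<^bsub>R\<^esub> b (inv\<^bsub>G\<^esub> k \<otimes>\<^bsub>G\<^esub> h)) \<otimes>\<^bsub>R\<^esub> c (inv\<^bsub>G\<^esub> h \<otimes>\<^bsub>G\<^esub> g))"
      unfolding mult_at[OF g] using a b c g by (intro R.finsum_cong') (auto simp: mult_at)
    also have "\<dots> = (\<Oplus>\<^bsub>R\<^esub>h\<in>carrier G. \<Oplus>\<^bsub>R\<^esub>k\<in>carrier G. ?t k h)"
      using a b c g by (intro R.finsum_cong') (auto simp: fin R.finsum_ldistr R.m_assoc intro!: R.finsum_cong')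
    also have "\<dots> = (\<Oplus>\<^bsub>R\<^esub>k\<in>carrier G. \<Oplus>\<^bsub>R\<^esub>h\<in>carrier G. ?t k h)"
      using a b c g by (intro R.finsum_swap) (auto simp: fin)
    also have "\<dots> = (\<Oplus>\<^bsub>R\<^esub>k\<in>carrier G. a k \<otimes>\<^bsub>R\<^esub> (b \<otimes>\<^bsub>S\<^esub> c) (inv\<^bsub>G\<^esub> k \<otimes>\<^bsub>G\<^esub> g))"
    proof (intro R.finsum_cong' refl)
      fix k assume k: "k \<in> carrier G"
      let ?s = "\<lambda>m. b m \<otimes>\<^bsub>R\<^esub> c (inv\<^bsub>G\<^esub> m \<otimes>\<^bsub>G\<^esub> (inv\<^bsub>G\<^esub> k \<otimes>\<^bsub>G\<^esub> g))"
      have "(\<Oplus>\<^bsub>R\<^esub>h\<in>carrier G. ?t k h) = a k \<otimes>\<^bsub>R\<^esub>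
          (\<Oplus>\<^bsub>R\<^esub>h\<in>carrier G. b (inv\<^bsub>G\<^esub> k \<otimes>\<^bsub>G\<^esub> h) \<otimes>\<^bsub>R\<^esub> c (inv\<^bsub>G\<^esub> h \<otimes>\<^bsub>G\<^esub> g))"
        using a b c g k by (intro R.finsum_rdistr[symmetric]) (auto simp: fin)
      also have "(\<Oplus>\<^bsub>R\<^esub>h\<in>carrier G. b (inv\<^bsub>G\<^esub> k \<otimes>\<^bsub>G\<^esub> h) \<otimes>\<^bsub>R\<^esub> c (inv\<^bsub>G\<^esub> h \<otimes>\<^bsub>G\<^esub> g)) =
          (\<Oplus>\<^bsub>R\<^esub>h\<in>carrier G. ?s (inv\<^bsub>G\<^esub> k \<otimes>\<^bsub>G\<^esub> h))"
      proof (intro R.finsum_cong' refl)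
        fix h assume h: "h \<in> carrier G"
        have "inv\<^bsub>G\<^esub> (inv\<^bsub>G\<^esub> k \<otimes>\<^bsub>G\<^esub> h) \<otimes>\<^bsub>G\<^esub> (inv\<^bsub>G\<^esub> k \<otimes>\<^bsub>G\<^esub> g) = inv\<^bsub>G\<^esub> h \<otimes>\<^bsub>G\<^esub> (k \<otimes>\<^bsub>G\<^esub> (inv\<^bsub>G\<^esub> k \<otimes>\<^bsub>G\<^esub> g))"
          using k h g by (simp add: G.inv_mult_group G.m_assoc)
        also have "k \<otimes>\<^bsub>G\<^esub> (inv\<^bsub>G\<^esub> k \<otimes>\<^bsub>G\<^esub> g) = g" using k g by (simp add: G.m_assoc[symmetric])
        finally show "b (inv\<^bsub>G\<^esub> k \<otimes>\<^bsub>G\<^esub> h) \<otimes>\<^bsub>R\<^esub> c (inv\<^bsub>G\<^esub> h \<otimes>\<^bsub>G\<^esub> g) = ?s (inv\<^bsub>G\<^esub> k \<otimes>\<^bsub>G\<^esub> h)" by simp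
      qed (use b c g k in auto)
      also have "\<dots> = (\<Oplus>\<^bsub>R\<^esub>h\<in>carrier G. ?s h)"
        using b c g k by (intro finsum_translate R.cring_axioms) auto
      also have "\<dots> = (b \<otimes>\<^bsub>S\<^esub> c) (inv\<^bsub>G\<^esub> k \<otimes>\<^bsub>G\<^esub> g)"
        using g k by (simp add: mult_at)
      finally show "(\<Oplus>\<^bsub>R\<^esub>h\<in>carrier G. ?t k h) = a k \<otimes>\<^bsub>R\<^esub> (b \<otimes>\<^bsub>S\<^esub> c) (inv\<^bsub>G\<^esub> k \<otimes>\<^bsub>G\<^esub> g)" .
    qed (use a b c g mult_S_closed in auto)
    finally show "(a \<otimes>\<^bsub>S\<^esub> b \<otimes>\<^bsub>S\<^esub> c) g = (a \<otimes>\<^bsub>S\<^esub> (b \<otimes>\<^bsub>S\<^esub> c)) g" using g by (simp add: mult_at)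
  qed (auto simp: a b c mult_S_closed)
  show "(a \<oplus>\<^bsub>S\<^esub> b) \<otimes>\<^bsub>S\<^esub> c = a \<otimes>\<^bsub>S\<^esub> c \<oplus>\<^bsub>S\<^esub> b \<otimes>\<^bsub>S\<^esub> c"
  proof (rule S_eqI)
    fix g assume g: "g \<in> carrier G"
    have "((a \<oplus>\<^bsub>S\<^esub> b) \<otimes>\<^bsub>S\<^esub> c) g = (\<Oplus>\<^bsub>R\<^esub>h\<in>carrier G.
        a h \<otimes>\<^bsub>R\<^esub> c (inv\<^bsub>G\<^esub> h \<otimes>\<^bsub>G\<^esub> g) \<oplus>\<^bsub>R\<^esub> b h \<otimes>\<^bsub>R\<^esub> c (inv\<^bsub>G\<^esub> h \<otimes>\<^bsub>G\<^esub> g))"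
      unfolding mult_at[OF g] using a b c g
      by (intro R.finsum_cong') (auto simp: add_at R.l_distr)
    then show "((a \<oplus>\<^bsub>S\<^esub> b) \<otimes>\<^bsub>S\<^esub> c) g = (a \<otimes>\<^bsub>S\<^esub> c \<oplus>\<^bsub>S\<^esub> b \<otimes>\<^bsub>S\<^esub> c) g"
      using a b c g by (simp add: mult_at add_at R.finsum_addf Pi_def)
  qed (auto simp: a b c mult_S_closed add_S_closed)
  show "a \<oplus>\<^bsub>S\<^esub> b \<oplus>\<^bsub>S\<^esub> c = a \<oplus>\<^bsub>S\<^esub> (b \<oplus>\<^bsub>S\<^esub> c)"
    using a b c by (intro S_eqI) (auto simp: add_S_closed add_at R.a_assoc)
  show "a \<oplus>\<^bsub>S\<^esub> b = b \<oplus>\<^bsub>S\<^esub> a"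
    using a b by (intro S_eqI) (auto simp: add_S_closed add_at R.a_comm)
  show "\<zero>\<^bsub>S\<^esub> \<oplus>\<^bsub>S\<^esub> a = a"
    using a by (intro S_eqI) (auto simp: add_S_closed zero_S_closed add_at zero_at)
qed (auto simp: mult_S_closed add_S_closed one_S_closed zero_S_closed)

sublocale S: cring S by (rule group_ring_cring)

lemma single_mult_single:
  assumes "h \<in> carrier G" "k \<in> carrier G" "c \<in> carrier R" "d \<in> carrier R"
  shows "single h c \<otimes>\<^bsub>S\<^esub> single k d = single (h \<otimes>\<^bsub>G\<^esub> k) (c \<otimes>\<^bsub>R\<^esub> d)"
proof (rule S_eqI)
  fix g assume g: "g \<in> carrier G"
  have "inv\<^bsub>G\<^esub> h \<otimes>\<^bsub>G\<^esub> g = k \<longleftrightarrow> g = h \<otimes>\<^bsub>G\<^esub> k"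
    using G.inv_solve_left'[of k h g] assms g by (auto simp: G.m_assoc[symmetric])
  then show "(single h c \<otimes>\<^bsub>S\<^esub> single k d) g = single (h \<otimes>\<^bsub>G\<^esub> k) (c \<otimes>\<^bsub>R\<^esub> d) g"
    using assms g by (auto simp: single_mult_at single_at)
qed (use assms in auto)

lemma single_hom: "single \<one>\<^bsub>G\<^esub> \<in> ring_hom R S"
proof (rule ring_hom_memI)
  fix c d assume "c \<in> carrier R" "d \<in> carrier R"
  then show "single \<one>\<^bsub>G\<^esub> (c \<oplus>\<^bsub>R\<^esub> d) = single \<one>\<^bsub>G\<^esub> c \<oplus>\<^bsub>S\<^esub> single \<one>\<^bsub>G\<^esub> d"
    by (intro S_eqI) (auto simp: single_at add_at)
qed (auto simp: single_mult_single one_S)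

lemma single_pow:
  "h \<in> carrier G \<Longrightarrow> single h \<one>\<^bsub>R\<^esub> [^]\<^bsub>S\<^esub> (n::nat) = single (h [^]\<^bsub>G\<^esub> n) \<one>\<^bsub>R\<^esub>"
  by (induction n) (auto simp: one_S single_mult_single)

text \<open>
  The linear extension of a character \<open>\<psi>\<close> of \<open>G\<close> along a map \<open>\<phi>\<close> of the coefficients.
\<close>

definition evaluation :: "('t, 'k) ring_scheme \<Rightarrow> ('r \<Rightarrow> 't) \<Rightarrow> ('g \<Rightarrow> 't) \<Rightarrow> ('g \<Rightarrow> 'r) \<Rightarrow> 't" where
  "evaluation T \<phi> \<psi> a = (\<Oplus>\<^bsub>T\<^esub>g\<in>carrier G. \<phi> (a g) \<otimes>\<^bsub>T\<^esub> \<psi> g)"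

context
  fixes T :: "('t, 'k) ring_scheme" and \<phi> :: "'r \<Rightarrow> 't" and \<psi> :: "'g \<Rightarrow> 't"
  assumes T: "cring T" and \<phi>: "\<phi> \<in> ring_hom R T"
    and \<psi>: "\<And>g. g \<in> carrier G \<Longrightarrow> \<psi> g \<in> carrier T"
      "\<And>g h. \<lbrakk>g \<in> carrier G; h \<in> carrier G\<rbrakk> \<Longrightarrow> \<psi> (g \<otimes>\<^bsub>G\<^esub> h) = \<psi> g \<otimes>\<^bsub>T\<^esub> \<psi> h"
      "\<psi> \<one>\<^bsub>G\<^esub> = \<one>\<^bsub>T\<^esub>"
begin

lemma evaluation_single:
  assumes "h \<in> carrier G" "c \<in> carrier R"
  shows "evaluation T \<phi> \<psi> (single h c) = \<phi> c \<otimes>\<^bsub>T\<^esub> \<psi> h"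
proof -
  interpret T: cring T by (rule T)
  interpret \<phi>: ring_hom_cring R T \<phi>
    by (intro ring_hom_cring.intro ring_hom_cring_axioms.intro R.cring_axioms T \<phi>)
  have "evaluation T \<phi> \<psi> (single h c) =
      (\<Oplus>\<^bsub>T\<^esub>g\<in>carrier G. if h = g then \<phi> c \<otimes>\<^bsub>T\<^esub> \<psi> g else \<zero>\<^bsub>T\<^esub>)"
    unfolding evaluation_def using assms \<psi> by (intro T.finsum_cong') (auto simp: single_at)
  also have "\<dots> = \<phi> c \<otimes>\<^bsub>T\<^esub> \<psi> h"
    using assms fin \<psi> by (intro T.finsum_singleton) auto
  finally show ?thesis .
qed

lemma evaluation_hom: "evaluation T \<phi> \<psi> \<in> ring_hom S T"
proof -
  interpret T: cring T by (rule T)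
  interpret \<phi>: ring_hom_cring R T \<phi>
    by (intro ring_hom_cring.intro ring_hom_cring_axioms.intro R.cring_axioms T \<phi>)
  show ?thesis
  proof (rule ring_hom_memI)
    fix a assume a: "a \<in> carrier S"
    show "evaluation T \<phi> \<psi> a \<in> carrier T"
      unfolding evaluation_def using a \<psi> by (intro T.finsum_closed) auto
    fix b assume b: "b \<in> carrier S"
    show "evaluation T \<phi> \<psi> (a \<oplus>\<^bsub>S\<^esub> b) = evaluation T \<phi> \<psi> a \<oplus>\<^bsub>T\<^esub> evaluation T \<phi> \<psi> b"
    proof -
      have "evaluation T \<phi> \<psi> (a \<oplus>\<^bsub>S\<^esub> b) =
          (\<Oplus>\<^bsub>T\<^esub>g\<in>carrier G. \<phi> (a g) \<otimes>\<^bsub>T\<^esub> \<psi> g \<oplus>\<^bsub>T\<^esub> \<phi> (b g) \<otimes>\<^bsub>T\<^esub> \<psi> g)"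
        unfolding evaluation_def using a b \<psi>
        by (intro T.finsum_cong') (auto simp: add_at T.l_distr)
      then show ?thesis unfolding evaluation_def using a b \<psi> by (subst (asm) T.finsum_addf) auto
    qed
    let ?t = "\<lambda>h g. (\<phi> (a h) \<otimes>\<^bsub>T\<^esub> \<psi> h) \<otimes>\<^bsub>T\<^esub>
        (\<phi> (b (inv\<^bsub>G\<^esub> h \<otimes>\<^bsub>G\<^esub> g)) \<otimes>\<^bsub>T\<^esub> \<psi> (inv\<^bsub>G\<^esub> h \<otimes>\<^bsub>G\<^esub> g))"
    have "evaluation T \<phi> \<psi> (a \<otimes>\<^bsub>S\<^esub> b) = (\<Oplus>\<^bsub>T\<^esub>g\<in>carrier G. \<Oplus>\<^bsub>T\<^esub>h\<in>carrier G. ?t h g)"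
      unfolding evaluation_def
    proof (intro T.finsum_cong' refl)
      fix g assume g: "g \<in> carrier G"
      have "\<phi> ((a \<otimes>\<^bsub>S\<^esub> b) g) \<otimes>\<^bsub>T\<^esub> \<psi> g =
          (\<Oplus>\<^bsub>T\<^esub>h\<in>carrier G. \<phi> (a h) \<otimes>\<^bsub>T\<^esub> \<phi> (b (inv\<^bsub>G\<^esub> h \<otimes>\<^bsub>G\<^esub> g))) \<otimes>\<^bsub>T\<^esub> \<psi> g"
        unfolding mult_at[OF g] using a b g
        by (subst \<phi>.hom_finsum) (auto intro!: T.finsum_cong' arg_cong2[where f = "\<lambda>x y. x \<otimes>\<^bsub>T\<^esub> y"])
      also have "\<dots> = (\<Oplus>\<^bsub>T\<^esub>h\<in>carrier G. \<phi> (a h) \<otimes>\<^bsub>T\<^esub> \<phi> (b (inv\<^bsub>G\<^esub> h \<otimes>\<^bsub>G\<^esub> g)) \<otimes>\<^bsub>T\<^esub> \<psi> g)"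
        using a b g \<psi> by (intro T.finsum_ldistr) (auto simp: fin)
      also have "\<dots> = (\<Oplus>\<^bsub>T\<^esub>h\<in>carrier G. ?t h g)"
      proof (intro T.finsum_cong' refl)
        fix h assume h: "h \<in> carrier G"
        have "\<psi> g = \<psi> (h \<otimes>\<^bsub>G\<^esub> (inv\<^bsub>G\<^esub> h \<otimes>\<^bsub>G\<^esub> g))" using h g by (simp add: G.m_assoc[symmetric])
        also have "\<dots> = \<psi> h \<otimes>\<^bsub>T\<^esub> \<psi> (inv\<^bsub>G\<^esub> h \<otimes>\<^bsub>G\<^esub> g)" using h g by (intro \<psi>(2)) auto
        finally show "\<phi> (a h) \<otimes>\<^bsub>T\<^esub> \<phi> (b (inv\<^bsub>G\<^esub> h \<otimes>\<^bsub>G\<^esub> g)) \<otimes>\<^bsub>T\<^esub> \<psi> g = ?t h g"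
          using a b g h \<psi>(1) by (simp add: T.m_ac)
      qed (use a b g \<psi>(1) in auto)
      finally show "\<phi> ((a \<otimes>\<^bsub>S\<^esub> b) g) \<otimes>\<^bsub>T\<^esub> \<psi> g = (\<Oplus>\<^bsub>T\<^esub>h\<in>carrier G. ?t h g)" .
    qed (use a b \<psi>(1) in auto)
    also have "\<dots> = (\<Oplus>\<^bsub>T\<^esub>h\<in>carrier G. \<Oplus>\<^bsub>T\<^esub>g\<in>carrier G. ?t h g)"
      using a b \<psi>(1) by (intro T.finsum_swap) (auto simp: fin)
    also have "\<dots> = (\<Oplus>\<^bsub>T\<^esub>h\<in>carrier G. \<phi> (a h) \<otimes>\<^bsub>T\<^esub> \<psi> h \<otimes>\<^bsub>T\<^esub> evaluation T \<phi> \<psi> b)"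
    proof (intro T.finsum_cong' refl)
      fix h assume h: "h \<in> carrier G"
      let ?s = "\<lambda>g. \<phi> (b g) \<otimes>\<^bsub>T\<^esub> \<psi> g"
      have "(\<Oplus>\<^bsub>T\<^esub>g\<in>carrier G. ?t h g) =
          \<phi> (a h) \<otimes>\<^bsub>T\<^esub> \<psi> h \<otimes>\<^bsub>T\<^esub> (\<Oplus>\<^bsub>T\<^esub>g\<in>carrier G. ?s (inv\<^bsub>G\<^esub> h \<otimes>\<^bsub>G\<^esub> g))"
        using a b h \<psi>(1) by (intro T.finsum_rdistr[symmetric]) (auto simp: fin)
      also have "(\<Oplus>\<^bsub>T\<^esub>g\<in>carrier G. ?s (inv\<^bsub>G\<^esub> h \<otimes>\<^bsub>G\<^esub> g)) = evaluation T \<phi> \<psi> b"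
        unfolding evaluation_def using b h \<psi>(1) by (intro finsum_translate T) auto
      finally show "(\<Oplus>\<^bsub>T\<^esub>g\<in>carrier G. ?t h g) = \<phi> (a h) \<otimes>\<^bsub>T\<^esub> \<psi> h \<otimes>\<^bsub>T\<^esub> evaluation T \<phi> \<psi> b" .
    qed (use a b \<psi>(1) in \<open>auto simp: evaluation_def\<close>)
    also have "\<dots> = evaluation T \<phi> \<psi> a \<otimes>\<^bsub>T\<^esub> evaluation T \<phi> \<psi> b"
      unfolding evaluation_def[of T \<phi> \<psi> a] using a b \<psi>(1)
      by (intro T.finsum_ldistr[symmetric]) (auto simp: fin evaluation_def)
    finally show "evaluation T \<phi> \<psi> (a \<otimes>\<^bsub>S\<^esub> b) = evaluation T \<phi> \<psi> a \<otimes>\<^bsub>T\<^esub> evaluation T \<phi> \<psi> b" .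
  next
    show "evaluation T \<phi> \<psi> \<one>\<^bsub>S\<^esub> = \<one>\<^bsub>T\<^esub>"
      unfolding one_S using evaluation_single[of "\<one>\<^bsub>G\<^esub>" "\<one>\<^bsub>R\<^esub>"] \<psi>(3) by simp
  qed
qed

end

text \<open>
  The augmentation ideal of a cyclic group is generated by \<open>u - 1\<close>, as \<open>u - 1\<close> divides every
  \<open>u ^ l - 1\<close>. The elements of the stated form are closed under addition, which allows an induction
  on the support of \<open>f\<close>.
\<close>

lemma augmentation_decomposition:
  assumes u: "u \<in> carrier G" and gen: "\<And>g. g \<in> carrier G \<Longrightarrow> \<exists>l::nat. g = u [^]\<^bsub>G\<^esub> l"
    and f: "f \<in> carrier S"
  shows "\<exists>c\<in>carrier R. \<exists>g\<in>carrier S.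
    f = single \<one>\<^bsub>G\<^esub> c \<oplus>\<^bsub>S\<^esub> (single u \<one>\<^bsub>R\<^esub> \<ominus>\<^bsub>S\<^esub> \<one>\<^bsub>S\<^esub>) \<otimes>\<^bsub>S\<^esub> g"
proof -
  interpret \<sigma>: ring_hom_cring R S "single \<one>\<^bsub>G\<^esub>"
    by (intro ring_hom_cring.intro ring_hom_cring_axioms.intro R.cring_axioms group_ring_cring single_hom)
  define x where "x = single u \<one>\<^bsub>R\<^esub> \<ominus>\<^bsub>S\<^esub> \<one>\<^bsub>S\<^esub>"
  have x [simp]: "x \<in> carrier S" by (simp add: x_def)
  let ?J = "\<lambda>f. \<exists>c\<in>carrier R. \<exists>g\<in>carrier S. f = single \<one>\<^bsub>G\<^esub> c \<oplus>\<^bsub>S\<^esub> x \<otimes>\<^bsub>S\<^esub> g"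
  have J_single: "?J (single h c)" if hc: "h \<in> carrier G" "c \<in> carrier R" for h c
  proof -
    obtain l :: nat where l: "h = u [^]\<^bsub>G\<^esub> l" using gen hc by blast
    \<comment> \<open>Every power of \<open>u\<close> is 1 plus a multiple of \<open>x\<close>.\<close>
    have "\<exists>s\<in>carrier S. single u \<one>\<^bsub>R\<^esub> [^]\<^bsub>S\<^esub> l = \<one>\<^bsub>S\<^esub> \<oplus>\<^bsub>S\<^esub> x \<otimes>\<^bsub>S\<^esub> s"
    proof (cases l)
      case 0
      then show ?thesis by (intro bexI[of _ "\<zero>\<^bsub>S\<^esub>"]) auto
    next
      case (Suc n)
      have "\<one>\<^bsub>S\<^esub> \<oplus>\<^bsub>S\<^esub> x \<otimes>\<^bsub>S\<^esub> geometric_sum S (single u \<one>\<^bsub>R\<^esub>) n = single u \<one>\<^bsub>R\<^esub> [^]\<^bsub>S\<^esub> l"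
        unfolding x_def Suc using S.geometric_sum_telescope[of "single u \<one>\<^bsub>R\<^esub>" n]
        by (simp add: S.minus_eq S.a_comm[of _ "\<ominus>\<^bsub>S\<^esub> _"] S.r_neg2 del: S.nat_pow_Suc)
      then show ?thesis by (intro bexI[of _ "geometric_sum S (single u \<one>\<^bsub>R\<^esub>) n"]) auto
    qed
    then obtain s where s [simp]: "s \<in> carrier S"
      "single u \<one>\<^bsub>R\<^esub> [^]\<^bsub>S\<^esub> l = \<one>\<^bsub>S\<^esub> \<oplus>\<^bsub>S\<^esub> x \<otimes>\<^bsub>S\<^esub> s" by blast
    have "single h c = single \<one>\<^bsub>G\<^esub> c \<otimes>\<^bsub>S\<^esub> single u \<one>\<^bsub>R\<^esub> [^]\<^bsub>S\<^esub> l"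
      unfolding single_pow[OF u] l using hc u by (simp add: single_mult_single)
    also have "\<dots> = single \<one>\<^bsub>G\<^esub> c \<oplus>\<^bsub>S\<^esub> x \<otimes>\<^bsub>S\<^esub> (single \<one>\<^bsub>G\<^esub> c \<otimes>\<^bsub>S\<^esub> s)"
      using hc by (simp add: S.r_distr S.m_lcomm)
    finally show ?thesis using hc by (intro bexI[of _ c] bexI) auto
  qed
  have J_add: "?J (f \<oplus>\<^bsub>S\<^esub> f')" if ff: "?J f" "?J f'" for f f'
  proof -
    obtain c g c' g' where [simp]: "c \<in> carrier R" "g \<in> carrier S" "c' \<in> carrier R" "g' \<in> carrier S"
      and e: "f = single \<one>\<^bsub>G\<^esub> c \<oplus>\<^bsub>S\<^esub> x \<otimes>\<^bsub>S\<^esub> g" "f' = single \<one>\<^bsub>G\<^esub> c' \<oplus>\<^bsub>S\<^esub> x \<otimes>\<^bsub>S\<^esub> g'"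
      using ff by blast
    have "f \<oplus>\<^bsub>S\<^esub> f' = single \<one>\<^bsub>G\<^esub> (c \<oplus>\<^bsub>R\<^esub> c') \<oplus>\<^bsub>S\<^esub> x \<otimes>\<^bsub>S\<^esub> (g \<oplus>\<^bsub>S\<^esub> g')"
      by (simp add: e S.r_distr S.a_ac)
    then show ?thesis by (intro bexI[of _ "c \<oplus>\<^bsub>R\<^esub> c'"] bexI[of _ "g \<oplus>\<^bsub>S\<^esub> g'"]) auto
  qed
  have "\<forall>f\<in>carrier S. (\<forall>g\<in>carrier G - A. f g = \<zero>\<^bsub>R\<^esub>) \<longrightarrow> ?J f"
    if "finite A" "A \<subseteq> carrier G" for A
    using that
  proof (induction A)
    case empty
    have "f = single \<one>\<^bsub>G\<^esub> \<zero>\<^bsub>R\<^esub> \<oplus>\<^bsub>S\<^esub> x \<otimes>\<^bsub>S\<^esub> \<zero>\<^bsub>S\<^esub>"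
      if "f \<in> carrier S" "\<forall>g\<in>carrier G. f g = \<zero>\<^bsub>R\<^esub>" for f
      using that by (intro S_eqI) (auto simp: zero_at)
    then show ?case using R.zero_closed S.zero_closed by (metis Diff_empty)
  next
    case (insert h A)
    show ?case
    proof (intro ballI impI)
      fix f assume f: "f \<in> carrier S" and supp: "\<forall>g\<in>carrier G - insert h A. f g = \<zero>\<^bsub>R\<^esub>"
      let ?f = "f(h := \<zero>\<^bsub>R\<^esub>)"
      have h: "h \<in> carrier G" using insert by auto
      have f' [simp]: "?f \<in> carrier S" using f h by (auto simp: carrier_S PiE_def extensional_def)
      have "f = ?f \<oplus>\<^bsub>S\<^esub> single h (f h)"
        using f h f' by (intro S_eqI S.a_closed single_closed) (auto simp: add_at single_at)
      moreover have "?J ?f" using insert f' supp by auto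
      ultimately show "?J f" using J_add J_single[of h "f h"] f h by (metis S_closed)
    qed
  qed
  from this[OF fin] show ?thesis using f unfolding x_def by auto
qed

lemma rnorm_S: "rnorm S a = Max ((\<lambda>g. rnorm R (a g)) ` carrier G)"
  by (simp add: group_ring_def)

lemma rnorm_S_le_iff: "rnorm S a \<le> b \<longleftrightarrow> (\<forall>g\<in>carrier G. rnorm R (a g) \<le> b)"
  unfolding rnorm_S using fin G.one_closed by (subst Max_le_iff) auto

end

section \<open>The group ring of a cyclic group of prime power order\<close>

lemma (in ring_hom_ring) hom_of_nat:
  "h ([(n::nat)] \<cdot>\<^bsub>R\<^esub> \<one>\<^bsub>R\<^esub>) = [n] \<cdot>\<^bsub>S\<^esub> \<one>\<^bsub>S\<^esub>"
  by (induction n) auto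

lemma (in ring_hom_ring) hom_q_at:
  assumes "y \<in> carrier R"
  shows "h (q_at R p k y) = q_at S p k (h y)"
proof -
  have "h (y \<ominus>\<^bsub>R\<^esub> \<one>\<^bsub>R\<^esub>) = h y \<ominus>\<^bsub>S\<^esub> \<one>\<^bsub>S\<^esub>" using assms by (simp add: R.minus_eq S.minus_eq)
  then show ?thesis using assms by (simp add: q_at_def hom_geometric_sum hom_nat_pow)
qed

lemma bounded_seminorm_cong:
  assumes "bounded_seminorm R \<nu>" "\<And>a. a \<in> carrier R \<Longrightarrow> \<mu> a = \<nu> a"
  shows "bounded_seminorm R \<mu>"
proof -
  interpret bounded_seminorm R \<nu> by fact
  show ?thesis
    using seminorm assms(2) le_one one_one
    by unfold_locales (auto simp: multiplicative_seminorm_def)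
qed

text \<open>
  The triangle inequality survives exponents greater than 1 because the seminorm is ultrametric.
\<close>

lemma (in bounded_seminorm) bounded_seminorm_powr:
  assumes "0 < \<omega>"
  shows "bounded_seminorm R (\<lambda>a. \<nu> a powr \<omega>)"
proof unfold_locales
  have max: "max s t powr \<omega> \<le> s powr \<omega> + t powr \<omega>" for s t :: real by (simp add: max_def)
  have "\<nu> (a \<ominus> b) powr \<omega> \<le> \<nu> a powr \<omega> + \<nu> b powr \<omega>" if "a \<in> carrier R" "b \<in> carrier R" for a b
    using powr_mono2[of \<omega> "\<nu> (a \<ominus> b)" "max (\<nu> a) (\<nu> b)"] add_le_max[of a "\<ominus> b"]
      max[of "\<nu> a" "\<nu> b"] that assms by (simp add: minus_eq neg nonneg)
  then show "multiplicative_seminorm R (\<lambda>a. \<nu> a powr \<omega>)"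
    using nonneg by (auto simp: multiplicative_seminorm_def zero mult powr_mult)
  show "\<nu> a powr \<omega> \<le> 1" if "a \<in> carrier R" for a
    using that assms le_one nonneg by (intro powr_le1) auto
  show "\<nu> \<one> powr \<omega> = 1" by (simp add: one_one)
qed

lemma (in seminormed_cring) finsum_le:
  assumes ultra: "\<And>a b. \<lbrakk>a \<in> carrier R; b \<in> carrier R\<rbrakk> \<Longrightarrow> \<nu> (a \<oplus> b) \<le> max (\<nu> a) (\<nu> b)"
    and f: "\<And>i. i \<in> A \<Longrightarrow> f i \<in> carrier R" "\<And>i. i \<in> A \<Longrightarrow> \<nu> (f i) \<le> B" and "0 \<le> B"
  shows "\<nu> (\<Oplus>i\<in>A. f i) \<le> B"
  using f
proof (induction A rule: infinite_finite_induct)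
  case (insert i A)
  have "\<nu> (f i \<oplus> (\<Oplus>i\<in>A. f i)) \<le> max (\<nu> (f i)) (\<nu> (\<Oplus>i\<in>A. f i))"
    using insert.prems by (intro ultra finsum_closed) auto
  also have "\<dots> \<le> B" using insert by auto
  finally show ?case using insert by (subst finsum_insert) auto
qed (use \<open>0 \<le> B\<close> in \<open>auto simp: zero\<close>)

lemma (in monoid) nat_pow_mod:
  assumes y: "y \<in> carrier G" and n: "y [^] (n::nat) = \<one>"
  shows "y [^] (l mod n) = y [^] l"
proof -
  have "y [^] l = y [^] (n * (l div n) + l mod n)" by simp
  also have "\<dots> = (y [^] n) [^] (l div n) \<otimes> y [^] (l mod n)"
    using y by (simp only: nat_pow_mult[symmetric] nat_pow_pow)
  finally show ?thesis using y by (simp add: n)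
qed

locale cyclic_p_group = padic p + group G for p and G :: "('g, 'n) monoid_scheme" (structure) +
  fixes N :: nat and u :: 'g
  assumes order_G: "order G = p ^ N" and u [simp]: "u \<in> carrier G"
    and gen: "generate G {u} = carrier G"
begin

lemma fin_G: "finite (carrier G)"
  using order_G order_gt_0_iff_finite p_gt_1 by simp

lemma ord_u: "ord u = p ^ N"
  using generate_pow_card[OF u] gen order_G by (simp add: order_def)

lemma carrier_pow: "carrier G = range (\<lambda>l::nat. u [^] l)"
  using generate_pow_nat[OF u] gen ord_u p_gt_1 by auto

lemma carrier_powE: "g \<in> carrier G \<Longrightarrow> \<exists>l::nat. g = u [^] l"
  using carrier_pow by auto

lemma u_pow_order: "u [^] (p ^ N) = \<one>"
  using pow_ord_eq_1[OF u] ord_u by simp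

lemma bij_pow: "bij_betw (\<lambda>l::nat. u [^] l) {..<p ^ N} (carrier G)"
proof -
  obtain m where "p ^ N = Suc m" using p_gt_1 by (cases "p ^ N") auto
  then have "{0..ord u - 1} = {..<p ^ N}" using ord_u by auto
  then have "inj_on (\<lambda>l::nat. u [^] l) {..<p ^ N}" using ord_inj[OF u] by simp
  moreover have "(\<lambda>l::nat. u [^] l) ` {..<p ^ N} = carrier G"
  proof (intro equalityI subsetI)
    fix g assume "g \<in> carrier G"
    then obtain l :: nat where "g = u [^] l" unfolding carrier_pow by blast
    then show "g \<in> (\<lambda>l::nat. u [^] l) ` {..<p ^ N}"
      using p_gt_1 nat_pow_mod[OF u u_pow_order, of l] by (intro image_eqI[of _ _ "l mod p ^ N"]) auto
  qed auto
  ultimately show ?thesis by (simp add: bij_betw_def)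
qed

lemma comm: "comm_group G"
proof (rule group_comm_groupI)
  fix g h assume "g \<in> carrier G" "h \<in> carrier G"
  then obtain l m :: nat where "g = u [^] l" "h = u [^] m" unfolding carrier_pow by blast
  then show "g \<otimes> h = h \<otimes> g" by (simp add: nat_pow_mult add.commute)
qed

sublocale finite_group_ring "Zp p" G
  using comm fin_G Zp_cring by (simp add: finite_group_ring_def finite_group_ring_axioms_def)

definition P where "P = [p] \<cdot>\<^bsub>S\<^esub> \<one>\<^bsub>S\<^esub>"
definition U where "U = single u \<one>\<^bsub>Zp p\<^esub>"

lemma U_closed [simp]: "U \<in> carrier S" and P_closed [simp]: "P \<in> carrier S"
  by (simp_all add: U_def P_def)

lemma P_single: "P = single \<one> ([p] \<cdot>\<^bsub>Zp p\<^esub> \<one>\<^bsub>Zp p\<^esub>)"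
proof -
  interpret ring_hom_ring "Zp p" S "single \<one>"
    by (intro ring_hom_ringI2 Zp.ring_axioms S.ring_axioms single_hom)
  show ?thesis unfolding P_def by (rule hom_of_nat[symmetric])
qed

lemma U_pow: "U [^]\<^bsub>S\<^esub> (p ^ N) = \<one>\<^bsub>S\<^esub>"
  unfolding U_def single_pow[OF u] by (simp add: u_pow_order one_S)

text \<open>
  Nilpotency of \<open>u - 1\<close> modulo \<open>p\<close> comes from applying the iterated Frobenius congruence to
  \<open>u = (u - 1) + 1\<close>, whose \<open>p ^ N\<close>-th power is 1.
\<close>

sublocale D: descent_ring S P "U \<ominus>\<^bsub>S\<^esub> \<one>\<^bsub>S\<^esub>"
proof
  interpret \<sigma>: ring_hom_ring "Zp p" S "single \<one>"
    by (intro ring_hom_ringI2 Zp.ring_axioms S.ring_axioms single_hom)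
  let ?x = "U \<ominus>\<^bsub>S\<^esub> \<one>\<^bsub>S\<^esub>"
  fix f assume "f \<in> carrier S"
  then obtain c g where c: "c \<in> carrier (Zp p)" and g: "g \<in> carrier S"
    and f: "f = single \<one> c \<oplus>\<^bsub>S\<^esub> ?x \<otimes>\<^bsub>S\<^esub> g"
    using augmentation_decomposition[OF u carrier_powE] unfolding U_def by blast
  from c show "(\<exists>e\<in>carrier S. \<exists>e'\<in>carrier S. \<exists>g\<in>carrier S. e \<otimes>\<^bsub>S\<^esub> e' = \<one>\<^bsub>S\<^esub> \<and> f = e \<oplus>\<^bsub>S\<^esub> ?x \<otimes>\<^bsub>S\<^esub> g) \<or>
      (\<exists>a\<in>carrier S. \<exists>g\<in>carrier S. f = P \<otimes>\<^bsub>S\<^esub> a \<oplus>\<^bsub>S\<^esub> ?x \<otimes>\<^bsub>S\<^esub> g)"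
  proof (cases rule: Zp_cases)
    case (unit y)
    then have "single \<one> c \<otimes>\<^bsub>S\<^esub> single \<one> y = \<one>\<^bsub>S\<^esub>"
      using c by (simp flip: \<sigma>.hom_mult)
    then show ?thesis using f c g unit
      by (intro disjI1 bexI[of _ "single \<one> c"] bexI[of _ "single \<one> y"] bexI[of _ g]) simp_all
  next
    case (multiple y)
    then have "single \<one> c = P \<otimes>\<^bsub>S\<^esub> single \<one> y"
      unfolding P_single by (simp add: \<sigma>.hom_mult)
    then show ?thesis using f g multiple
      by (intro disjI2 bexI[of _ "single \<one> y"] bexI[of _ g]) simp_all
  qed
next
  let ?x = "U \<ominus>\<^bsub>S\<^esub> \<one>\<^bsub>S\<^esub>"
  have x [simp]: "?x \<in> carrier S" by simp
  have "?x \<oplus>\<^bsub>S\<^esub> \<one>\<^bsub>S\<^esub> = U" by (simp add: S.minus_eq S.a_assoc S.l_neg)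
  then obtain s where s [simp]: "s \<in> carrier S"
    and e: "\<one>\<^bsub>S\<^esub> = ?x [^]\<^bsub>S\<^esub> (p ^ N) \<oplus>\<^bsub>S\<^esub> \<one>\<^bsub>S\<^esub> \<oplus>\<^bsub>S\<^esub> P \<otimes>\<^bsub>S\<^esub> s"
    using S.frobenius_power_one_plus[OF prime x, of N] U_pow unfolding P_def by auto
  define z where "z = ?x [^]\<^bsub>S\<^esub> (p ^ N)"
  have z [simp]: "z \<in> carrier S" by (simp add: z_def)
  have "\<one>\<^bsub>S\<^esub> \<oplus>\<^bsub>S\<^esub> (z \<oplus>\<^bsub>S\<^esub> P \<otimes>\<^bsub>S\<^esub> s) = \<one>\<^bsub>S\<^esub> \<oplus>\<^bsub>S\<^esub> \<zero>\<^bsub>S\<^esub>"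
    using e unfolding z_def[symmetric] by (simp add: S.a_ac)
  then have "z \<oplus>\<^bsub>S\<^esub> P \<otimes>\<^bsub>S\<^esub> s = \<zero>\<^bsub>S\<^esub>" using S.add.l_cancel by simp
  then have "z = P \<otimes>\<^bsub>S\<^esub> (\<ominus>\<^bsub>S\<^esub> s)" by (simp add: S.minus_equality S.r_minus)
  then show "\<exists>M::nat. \<exists>s\<in>carrier S. ?x [^]\<^bsub>S\<^esub> M = P \<otimes>\<^bsub>S\<^esub> s" unfolding z_def
    by (intro exI[of _ "p ^ N"] bexI[of _ "\<ominus>\<^bsub>S\<^esub> s"]) simp_all
qed simp_all

text \<open>
  The maximal ideal \<open>(p, u - 1)\<close> becomes principal modulo \<open>q\<^sub>k(u)\<close>: for \<open>k = 0\<close> the generator \<open>u - 1\<close> is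
  killed, and for \<open>k \<ge> 1\<close> the relation \<open>q\<^sub>k(u) = p + (u - 1) h\<close> makes \<open>p\<close> a multiple of \<open>u - 1\<close>.
\<close>

lemma uniformizer:
  "\<exists>\<pi>\<in>{P, U \<ominus>\<^bsub>S\<^esub> \<one>\<^bsub>S\<^esub>}. \<exists>h1\<in>carrier S. \<exists>h2\<in>carrier S.
     \<forall>\<nu>. bounded_seminorm S \<nu> \<longrightarrow> \<nu> (q_at S p k U) = 0 \<longrightarrow> D.uniformizes \<pi> h1 h2 \<nu>"
proof (cases k)
  case 0
  have "D.uniformizes P \<one>\<^bsub>S\<^esub> \<zero>\<^bsub>S\<^esub> \<nu>" if "bounded_seminorm S \<nu>" "\<nu> (q_at S p k U) = 0" for \<nu>
  proof -
    interpret bounded_seminorm S \<nu> by fact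
    have "P \<ominus>\<^bsub>S\<^esub> P \<otimes>\<^bsub>S\<^esub> \<one>\<^bsub>S\<^esub> = \<zero>\<^bsub>S\<^esub>" by simp
    moreover have "U \<ominus>\<^bsub>S\<^esub> \<one>\<^bsub>S\<^esub> \<ominus>\<^bsub>S\<^esub> P \<otimes>\<^bsub>S\<^esub> \<zero>\<^bsub>S\<^esub> = U \<ominus>\<^bsub>S\<^esub> \<one>\<^bsub>S\<^esub>" by (simp add: S.minus_eq)
    ultimately show ?thesis using that(2) 0
      by (simp only: D.uniformizes_def q_at_def zero) simp
  qed
  then show ?thesis by (intro bexI[of _ P] bexI[of _ "\<one>\<^bsub>S\<^esub>"] bexI[of _ "\<zero>\<^bsub>S\<^esub>"]) simp_all
next
  case (Suc j)
  let ?x = "U \<ominus>\<^bsub>S\<^esub> \<one>\<^bsub>S\<^esub>"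
  obtain h where h [simp]: "h \<in> carrier S"
    and q: "q_at S p k U = P \<oplus>\<^bsub>S\<^esub> ?x \<otimes>\<^bsub>S\<^esub> h"
    using S.q_at_congruent[of U p j] p_gt_1 unfolding Suc P_def by auto
  have "D.uniformizes ?x (\<ominus>\<^bsub>S\<^esub> h) \<one>\<^bsub>S\<^esub> \<nu>" if "bounded_seminorm S \<nu>" "\<nu> (q_at S p k U) = 0" for \<nu>
  proof -
    interpret bounded_seminorm S \<nu> by fact
    have "P \<ominus>\<^bsub>S\<^esub> ?x \<otimes>\<^bsub>S\<^esub> (\<ominus>\<^bsub>S\<^esub> h) = q_at S p k U"
      unfolding q by (simp only: S.minus_eq S.r_minus[OF S.minus_closed[OF U_closed S.one_closed, unfolded S.minus_eq] h]) simp
    moreover have "?x \<ominus>\<^bsub>S\<^esub> ?x \<otimes>\<^bsub>S\<^esub> \<one>\<^bsub>S\<^esub> = \<zero>\<^bsub>S\<^esub>" by simp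
    ultimately show ?thesis using that(2) by (simp only: D.uniformizes_def zero)
  qed
  then show ?thesis by (intro bexI[of _ ?x] bexI[of _ "\<ominus>\<^bsub>S\<^esub> h"] bexI[of _ "\<one>\<^bsub>S\<^esub>"]) simp_all
qed

lemma determined_on_component:
  assumes "bounded_seminorm S \<nu>" "\<nu> (q_at S p k U) = 0"
    and "bounded_seminorm S \<mu>" "\<mu> (q_at S p k U) = 0"
    and "0 < \<mu> P" "\<mu> P < 1" "0 < \<omega>" "\<nu> P = \<mu> P powr \<omega>" "f \<in> carrier S"
  shows "\<nu> f = \<mu> f powr \<omega>"
  using uniformizer[of k] assms by (metis D.seminorm_determined)

text \<open>
  The element \<open>u ^ (p ^ N) - 1 = 0\<close> is the product of the \<open>q\<^sub>k(u)\<close>, obtained by telescoping, and a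
  multiplicative seminorm which vanishes at a product vanishes at a factor.
\<close>

lemma component_exists:
  assumes "bounded_seminorm S \<nu>"
  shows "\<exists>k\<le>N. \<nu> (q_at S p k U) = 0"
proof -
  interpret bounded_seminorm S \<nu> by fact
  have "\<exists>k\<le>j. \<nu> (q_at S p k U) = 0" if "\<nu> (U [^]\<^bsub>S\<^esub> (p ^ j) \<ominus>\<^bsub>S\<^esub> \<one>\<^bsub>S\<^esub>) = 0" for j
    using that
  proof (induction j)
    case 0
    then show ?case by (simp add: q_at_def)
  next
    case (Suc j)
    have "\<nu> (U [^]\<^bsub>S\<^esub> (p ^ j) \<ominus>\<^bsub>S\<^esub> \<one>\<^bsub>S\<^esub>) * \<nu> (q_at S p (Suc j) U) = 0"
      using Suc.prems S.q_at_telescope[of U p j] p_gt_1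
      by (subst mult[symmetric]) auto
    then show ?case using Suc.IH by (auto simp: le_Suc_eq)
  qed
  then show ?thesis using U_pow zero by (simp add: S.minus_eq S.r_neg)
qed

lemma berkovich_bounded:
  assumes "\<nu> \<in> berkovich_points S"
  shows "bounded_seminorm S \<nu>" "\<nu> P \<le> 1 / real p"
proof -
  have \<nu>: "multiplicative_seminorm S \<nu>" "\<And>a. a \<in> carrier S \<Longrightarrow> \<nu> a \<le> rnorm S a"
    "\<exists>a\<in>carrier S. \<nu> a \<noteq> 0"
    using assms by (auto simp: berkovich_points_def)
  interpret seminormed_cring S \<nu> using \<nu>(1) by unfold_locales
  have "\<nu> a \<le> 1" if "a \<in> carrier S" for a
    using \<nu>(2)[OF that] rnorm_S_le_iff[of a 1] rnorm_Zp_le_1 by fastforce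
  moreover have "\<nu> \<one>\<^bsub>S\<^esub> = 1" using \<nu>(3) one by blast
  ultimately show "bounded_seminorm S \<nu>" by unfold_locales
  have "rnorm S P \<le> 1 / real p"
    unfolding rnorm_S_le_iff P_single using p_gt_1 rnorm_Zp_p
    by (auto simp: single_at rnorm_Zp_zero)
  then show "\<nu> P \<le> 1 / real p" using \<nu>(2)[OF P_closed] by simp
qed

end

section \<open>Roots of unity in the completed algebraic closure\<close>

lemma (in cring) geometric_sum_descending:
  assumes y: "y \<in> carrier R" and p: "0 < p"
  shows "(\<Oplus>i\<in>{1..p}. y [^] (m * (p - i))) = geometric_sum R (y [^] m) (p - 1)"
proof -
  have inj: "inj_on (\<lambda>j. p - j) {..p - 1}" using p by (auto simp: inj_on_def)
  have img: "(\<lambda>j. p - j) ` {..p - 1} = {1..p}"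
  proof (intro equalityI subsetI)
    fix i assume "i \<in> {1..p}"
    then show "i \<in> (\<lambda>j. p - j) ` {..p - 1}" by (intro image_eqI[of _ _ "p - i"]) auto
  qed (use p in auto)
  have "(\<Oplus>i\<in>{1..p}. y [^] (m * (p - i))) = (\<Oplus>j\<in>{..p - 1}. y [^] (m * (p - (p - j))))"
    using finsum_reindex[OF _ inj, of "\<lambda>i. y [^] (m * (p - i))"] y unfolding img by auto
  also have "\<dots> = (\<Oplus>j\<in>{..p - 1}. (y [^] m) [^] j)"
    using y p by (intro finsum_cong') (auto simp: nat_pow_pow)
  finally show ?thesis using y by (simp add: geometric_sum_finsum)
qed

lemma (in cring) q_at_zero:
  assumes "p > 0" shows "q_at R p k \<zero> = (if k = 0 then \<ominus> \<one> else \<one>)"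
proof -
  have "geometric_sum R \<zero> n = \<one>" for n by (induction n) auto
  moreover have "\<zero> [^] (p ^ (k - 1)) = \<zero>" using assms by (simp add: nat_pow_zero)
  ultimately show ?thesis by (simp add: q_at_def minus_eq)
qed

lemma (in domain) q_poly_eq:
  assumes "p > 0"
  shows "q_poly R p k = q_at (poly_ring R) p k X"
proof -
  interpret UP: cring "poly_ring R" by (rule univ_poly_is_cring[OF carrier_is_subring])
  show ?thesis using UP.geometric_sum_descending[OF var_closed(1)[OF carrier_is_subring] assms]
    by (simp add: q_poly_def q_at_def)
qed

lemma (in domain) eval_q_at:
  assumes F: "subring F R" and r: "r \<in> carrier R"
  shows "eval (q_at (F[X]) p k X) r = q_at R p k r"
proof -
  interpret H: ring_hom_cring "F[X]" R "\<lambda>f. eval f r" by (rule eval_cring_hom[OF F r])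
  show ?thesis using H.ring.hom_q_at[OF var_closed(1)[OF F]] eval_var[OF r] by simp
qed

lemma (in domain) is_root_q_poly_iff:
  assumes "p > 0"
  shows "is_root (q_poly R p k) r \<longleftrightarrow> r \<in> carrier R \<and> q_at R p k r = \<zero>"
proof -
  have "q_poly R p k \<noteq> []"
  proof
    assume "q_poly R p k = []"
    then have "q_at R p k \<zero> = \<zero>"
      using eval_q_at[OF carrier_is_subring zero_closed, of p k] q_poly_eq[OF assms, of k] by simp
    then show False using q_at_zero[OF assms, of k] by (auto split: if_splits)
  qed
  then show ?thesis
    using eval_q_at[OF carrier_is_subring] q_poly_eq[OF assms, of k] by (auto simp: is_root_def)
qed

lemma geometric_sum_carrier_update: "geometric_sum (K\<lparr>carrier := A\<rparr>) y n = geometric_sum K y n"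
  by (induction n) auto

lemma nat_pow_carrier_update: "y [^]\<^bsub>K\<lparr>carrier := A\<rparr>\<^esub> (n::nat) = y [^]\<^bsub>K\<^esub> n"
  by (simp add: nat_pow_def)

lemma q_at_carrier_update: "k > 0 \<Longrightarrow> q_at (K\<lparr>carrier := A\<rparr>) p k y = q_at K p k y"
  by (simp add: q_at_def geometric_sum_carrier_update nat_pow_carrier_update)

text \<open>
  A polynomial that takes two different values is not constant, so its multiset of roots, whose size
  is the degree, is not empty.
\<close>

lemma (in algebraic_closure) root_exists:
  assumes F: "f \<in> carrier (K[X])" and ab: "a \<in> carrier L" "b \<in> carrier L" "eval f a \<noteq> eval f b"
  shows "\<exists>r\<in>carrier L. eval f r = \<zero>"
proof -
  have f: "f \<in> carrier (poly_ring L)"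
    using carrier_polynomial_shell[OF subfieldE(1)[OF subfield_axioms] F] .
  have "degree f \<noteq> 0"
  proof
    assume "degree f = 0"
    then consider "f = []" | c where "f = [c]" by (cases f) auto
    then show False
    proof cases
      case 2
      then have "c \<in> carrier L" using f unfolding univ_poly_carrier[symmetric] polynomial_def by auto
      then show False using ab 2 by simp
    qed (use ab in simp)
  qed
  then have "roots f \<noteq> {#}" using roots_over_subfield[OF F] unfolding splitted_def by auto
  then obtain r where "r \<in># roots f" by blast
  then show ?thesis using roots_mem_iff_is_root[OF f] by (auto simp: is_root_def)
qed

locale padic_group_ring = cyclic_p_group p G N u
  for p and G :: "('g, 'n) monoid_scheme" (structure) and N :: nat and u :: 'g +
  fixes K :: "('c, 'm) normed_ring_scheme" and \<iota> :: "(nat \<Rightarrow> int) \<Rightarrow> 'c"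
  assumes Cp: "is_Cp p K \<iota>"
begin

sublocale K: field K using Cp by (simp add: is_Cp_def)

sublocale \<iota>: ring_hom_cring "Zp p" K \<iota>
  using Cp by unfold_locales (simp add: is_Cp_def)

abbreviation absK where "absK \<equiv> rnorm K"

lemma absK_iota: "a \<in> carrier (Zp p) \<Longrightarrow> absK (\<iota> a) = rnorm (Zp p) a"
  using Cp by (simp add: is_Cp_def)

lemma absK:
  shows absK_nonneg: "x \<in> carrier K \<Longrightarrow> 0 \<le> absK x"
    and absK_zero_iff: "x \<in> carrier K \<Longrightarrow> absK x = 0 \<longleftrightarrow> x = \<zero>\<^bsub>K\<^esub>"
    and absK_mult: "\<lbrakk>x \<in> carrier K; y \<in> carrier K\<rbrakk> \<Longrightarrow> absK (x \<otimes>\<^bsub>K\<^esub> y) = absK x * absK y"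
    and absK_add: "\<lbrakk>x \<in> carrier K; y \<in> carrier K\<rbrakk> \<Longrightarrow> absK (x \<oplus>\<^bsub>K\<^esub> y) \<le> absK x + absK y"
  using Cp by (auto simp: is_Cp_def absolute_value_def)

lemma absK_one: "absK \<one>\<^bsub>K\<^esub> = 1"
  using absK_mult[of "\<one>\<^bsub>K\<^esub>" "\<one>\<^bsub>K\<^esub>"] absK_zero_iff[of "\<one>\<^bsub>K\<^esub>"] by simp

lemma absK_neg: assumes "x \<in> carrier K" shows "absK (\<ominus>\<^bsub>K\<^esub> x) = absK x"
proof -
  have "absK (\<ominus>\<^bsub>K\<^esub> x) * absK (\<ominus>\<^bsub>K\<^esub> x) = absK x * absK x"
    using absK_mult[of "\<ominus>\<^bsub>K\<^esub> x" "\<ominus>\<^bsub>K\<^esub> x"] absK_mult[of x x] assms by (simp add: K.l_minus K.r_minus)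
  then show ?thesis using absK_nonneg assms by (metis K.a_inv_closed abs_of_nonneg real_sqrt_abs2)
qed

sublocale V: seminormed_cring K absK
proof unfold_locales
  show "multiplicative_seminorm K absK"
    unfolding multiplicative_seminorm_def
  proof (intro conjI ballI)
    fix x y assume "x \<in> carrier K" "y \<in> carrier K"
    then show "absK (x \<ominus>\<^bsub>K\<^esub> y) \<le> absK x + absK y"
      using absK_add[of x "\<ominus>\<^bsub>K\<^esub> y"] absK_neg[of y] by (simp add: K.minus_eq)
  qed (auto simp: absK_nonneg absK_mult absK_zero_iff)
qed

text \<open>
  The coefficients for the general criterion are the \<open>p\<close>-adic integers, on which the absolute value is
  at most 1.
\<close>

lemma absK_ultrametric:
  "\<lbrakk>x \<in> carrier K; y \<in> carrier K\<rbrakk> \<Longrightarrow> absK (x \<oplus>\<^bsub>K\<^esub> y) \<le> max (absK x) (absK y)"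
proof (rule V.ultrametric[of "\<iota> ` carrier (Zp p)"])
  show "\<one>\<^bsub>K\<^esub> \<in> \<iota> ` carrier (Zp p)" by (metis imageI Zp.one_closed \<iota>.hom_one)
  show "m \<oplus>\<^bsub>K\<^esub> m' \<in> \<iota> ` carrier (Zp p)"
    if "m \<in> \<iota> ` carrier (Zp p)" "m' \<in> \<iota> ` carrier (Zp p)" for m m'
    using that by (auto simp flip: \<iota>.hom_add)
qed (auto simp: absK_iota rnorm_Zp_le_1)

lemma absK_p: "absK ([p] \<cdot>\<^bsub>K\<^esub> \<one>\<^bsub>K\<^esub>) = 1 / real p"
  using absK_iota[of "[p] \<cdot>\<^bsub>Zp p\<^esub> \<one>\<^bsub>Zp p\<^esub>"] by (simp add: \<iota>.ring.hom_of_nat rnorm_Zp_p)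

lemma p_nonzero_K: "[p] \<cdot>\<^bsub>K\<^esub> \<one>\<^bsub>K\<^esub> \<noteq> \<zero>\<^bsub>K\<^esub>"
  using absK_p absK_zero_iff[of "[p] \<cdot>\<^bsub>K\<^esub> \<one>\<^bsub>K\<^esub>"] p_gt_1 by auto

lemma is_root_iff: "ring.is_root K (q_poly K p k) r \<longleftrightarrow> r \<in> carrier K \<and> q_at K p k r = \<zero>\<^bsub>K\<^esub>"
  using K.is_root_q_poly_iff p_gt_1 by simp

text \<open>
  For \<open>k \<ge> 1\<close> the polynomial has coefficients in the field of \<open>p\<close>-adic numbers, of which \<open>A\<close> is
  an algebraic closure, and it is not constant: its values at 0 and 1 are 1 and \<open>p\<close>, and these differ
  in absolute value.
\<close>

lemma q_at_root_exists: "\<exists>r\<in>carrier K. q_at K p k r = \<zero>\<^bsub>K\<^esub>"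
proof (cases "k = 0")
  case True
  then show ?thesis by (intro bexI[of _ "\<one>\<^bsub>K\<^esub>"]) (auto simp: q_at_def K.minus_eq K.r_neg)
next
  case False
  obtain A where A: "algebraic_closure (K\<lparr>carrier := A\<rparr>) (Qp_in p K \<iota>)" "A \<subseteq> carrier K"
    using Cp by (auto simp: is_Cp_def dense_in_normed_def)
  let ?L = "K\<lparr>carrier := A\<rparr>" and ?F = "Qp_in p K \<iota>"
  interpret L: algebraic_closure ?L ?F by (rule A(1))
  have F: "subring ?F ?L" using subfieldE(1)[OF L.subfield_axioms] .
  let ?f = "q_at (?F[X]\<^bsub>?L\<^esub>) p k X\<^bsub>?L\<^esub>"
  interpret UP: cring "?F[X]\<^bsub>?L\<^esub>" by (rule L.univ_poly_is_cring[OF F])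
  have f: "?f \<in> carrier (?F[X]\<^bsub>?L\<^esub>)" by (rule UP.q_at_closed[OF L.var_closed(1)[OF F]])
  have ev: "L.eval ?f r = q_at K p k r" if "r \<in> A" for r
    using L.eval_q_at[OF F, of r p k] that False by (simp add: q_at_carrier_update)
  have A01: "\<zero>\<^bsub>K\<^esub> \<in> A" "\<one>\<^bsub>K\<^esub> \<in> A" using L.zero_closed monoid.one_closed[OF L.monoid_axioms] by simp_all
  have "q_at K p k \<zero>\<^bsub>K\<^esub> = \<one>\<^bsub>K\<^esub>" using K.q_at_zero[of p k] False p_gt_1 by simp
  moreover have "q_at K p k \<one>\<^bsub>K\<^esub> = [p] \<cdot>\<^bsub>K\<^esub> \<one>\<^bsub>K\<^esub>"
    using K.q_at_one_power[of "\<one>\<^bsub>K\<^esub>" p "k - 1"] False p_gt_1 by simp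
  moreover have "[p] \<cdot>\<^bsub>K\<^esub> \<one>\<^bsub>K\<^esub> \<noteq> \<one>\<^bsub>K\<^esub>" using absK_p absK_one p_gt_1 by auto
  ultimately have "L.eval ?f \<zero>\<^bsub>K\<^esub> \<noteq> L.eval ?f \<one>\<^bsub>K\<^esub>" using ev A01 by simp
  then obtain r where "r \<in> A" "L.eval ?f r = \<zero>\<^bsub>K\<^esub>"
    using L.root_exists[OF f, of "\<zero>\<^bsub>K\<^esub>" "\<one>\<^bsub>K\<^esub>"] A01 by auto
  then show ?thesis using ev A(2) by auto
qed

lemma root_pow:
  assumes r: "r \<in> carrier K" "q_at K p k r = \<zero>\<^bsub>K\<^esub>" and "k \<le> j"
  shows "r [^]\<^bsub>K\<^esub> (p ^ j) = \<one>\<^bsub>K\<^esub>"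
proof -
  have "r [^]\<^bsub>K\<^esub> (p ^ k) \<ominus>\<^bsub>K\<^esub> \<one>\<^bsub>K\<^esub> = \<zero>\<^bsub>K\<^esub>"
  proof (cases k)
    case 0
    then show ?thesis using r by (simp add: q_at_def)
  next
    case (Suc i)
    then show ?thesis using K.q_at_telescope[of r p i] r p_gt_1 by simp
  qed
  then have "r [^]\<^bsub>K\<^esub> (p ^ k) = \<one>\<^bsub>K\<^esub>" using r by simp
  moreover have "r [^]\<^bsub>K\<^esub> (p ^ j) = (r [^]\<^bsub>K\<^esub> (p ^ k)) [^]\<^bsub>K\<^esub> (p ^ (j - k))"
    using r \<open>k \<le> j\<close> by (simp add: K.nat_pow_pow power_add[symmetric])
  ultimately show ?thesis by simp
qed

text \<open>
  If \<open>r ^ (p ^ i) = 1\<close> then \<open>q\<^sub>k(r) = p\<close> for \<open>k = i + 1\<close>, which is not zero in \<open>K\<close>. This makes the roots of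
  \<open>q\<^sub>k\<close> primitive roots of unity.
\<close>

lemma root_pow_less:
  assumes r: "r \<in> carrier K" "q_at K p k r = \<zero>\<^bsub>K\<^esub>" and "j < k"
  shows "r [^]\<^bsub>K\<^esub> (p ^ j) \<noteq> \<one>\<^bsub>K\<^esub>"
proof
  assume one: "r [^]\<^bsub>K\<^esub> (p ^ j) = \<one>\<^bsub>K\<^esub>"
  obtain i where i: "k = Suc i" "j \<le> i" using \<open>j < k\<close> by (cases k) auto
  have "r [^]\<^bsub>K\<^esub> (p ^ i) = (r [^]\<^bsub>K\<^esub> (p ^ j)) [^]\<^bsub>K\<^esub> (p ^ (i - j))"
    using r i by (simp add: K.nat_pow_pow power_add[symmetric])
  then have "q_at K p k r = [p] \<cdot>\<^bsub>K\<^esub> \<one>\<^bsub>K\<^esub>"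
    using K.q_at_one_power[of r p i] r one p_gt_1 i by simp
  then show False using r p_nonzero_K by simp
qed

text \<open>
  The character of \<open>G\<close> that sends \<open>u\<close> to \<open>r\<close>, defined through the discrete logarithm in \<open>{..<p ^ N}\<close>;
  it is multiplicative when \<open>r ^ (p ^ N) = 1\<close>.
\<close>

definition character :: "'c \<Rightarrow> 'g \<Rightarrow> 'c" where
  "character r g = r [^]\<^bsub>K\<^esub> the_inv_into {..<p ^ N} (\<lambda>l::nat. u [^] l) g"

abbreviation ev where "ev r \<equiv> evaluation K \<iota> (character r)"

context
  fixes r assumes r [simp]: "r \<in> carrier K" and r_order: "r [^]\<^bsub>K\<^esub> (p ^ N) = \<one>\<^bsub>K\<^esub>"
begin

lemma character_pow: "character r (u [^] (l::nat)) = r [^]\<^bsub>K\<^esub> l"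
proof -
  have "the_inv_into {..<p ^ N} (\<lambda>l::nat. u [^] l) (u [^] (l mod p ^ N)) = l mod p ^ N"
    using bij_pow p_gt_1 by (intro the_inv_into_f_f) (auto simp: bij_betw_def)
  then show ?thesis
    using nat_pow_mod[OF u u_pow_order, of l] K.nat_pow_mod[OF r r_order, of l]
    by (simp add: character_def)
qed

lemma character_hom:
  "g \<in> carrier G \<Longrightarrow> character r g \<in> carrier K"
  "\<lbrakk>g \<in> carrier G; h \<in> carrier G\<rbrakk> \<Longrightarrow> character r (g \<otimes> h) = character r g \<otimes>\<^bsub>K\<^esub> character r h"
  "character r \<one> = \<one>\<^bsub>K\<^esub>"
proof -
  show "character r g \<in> carrier K" by (simp add: character_def)
  show "character r (g \<otimes> h) = character r g \<otimes>\<^bsub>K\<^esub> character r h" if gh: "g \<in> carrier G" "h \<in> carrier G"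
  proof -
    obtain l m :: nat where "g = u [^] l" "h = u [^] m" using gh[THEN carrier_powE] by blast
    then show ?thesis using character_pow by (simp add: nat_pow_mult K.nat_pow_mult)
  qed
  show "character r \<one> = \<one>\<^bsub>K\<^esub>" using character_pow[of 0] by simp
qed

lemma ev_ring_hom: "ring_hom_ring S K (ev r)"
  using evaluation_hom[OF K.cring_axioms \<iota>.homh character_hom]
  by (intro ring_hom_ringI2 S.ring_axioms K.ring_axioms) auto

lemma ev_U: "ev r U = r"
  using evaluation_single[OF K.cring_axioms \<iota>.homh character_hom u Zp.one_closed]
    character_pow[of 1] by (simp add: U_def)

lemma ev_q_at: "ev r (q_at S p k U) = q_at K p k r"
  using ring_hom_ring.hom_q_at[OF ev_ring_hom U_closed] by (simp add: ev_U)

lemma ev_P: "ev r P = [p] \<cdot>\<^bsub>K\<^esub> \<one>\<^bsub>K\<^esub>"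
  using ring_hom_ring.hom_of_nat[OF ev_ring_hom] by (simp add: P_def)

lemma absK_r: "absK r = 1"
proof -
  have "absK r ^ (p ^ N) = 1"
    using V.pow[OF absK_one r, of "p ^ N"] r_order absK_one by simp
  then show ?thesis using absK_nonneg[OF r] p_gt_1
    
    by (intro power_eq_imp_eq_base[of "absK r" "p ^ N" 1]) auto
qed

lemma absK_ev_le:
  assumes a: "a \<in> carrier S"
  shows "absK (ev r a) \<le> rnorm S a"
  unfolding evaluation_def
proof (rule V.finsum_le[OF absK_ultrametric])
  fix g assume g: "g \<in> carrier G"
  show c: "\<iota> (a g) \<otimes>\<^bsub>K\<^esub> character r g \<in> carrier K" using a g character_hom(1) by auto
  have "absK (character r g) = 1"
    unfolding character_def using absK_r absK_one by (simp add: V.pow)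
  then have "absK (\<iota> (a g) \<otimes>\<^bsub>K\<^esub> character r g) = rnorm (Zp p) (a g)"
    using a g character_hom(1) by (simp add: absK_mult absK_iota)
  then show "absK (\<iota> (a g) \<otimes>\<^bsub>K\<^esub> character r g) \<le> rnorm S a"
    using rnorm_S_le_iff[of a "rnorm S a"] g by auto
next
  have "0 \<le> rnorm (Zp p) (a \<one>)" by (rule rnorm_Zp_nonneg)
  also have "\<dots> \<le> rnorm S a" using rnorm_S_le_iff[of a "rnorm S a"] by auto
  finally show "0 \<le> rnorm S a" .
qed

lemma absK_ev_bounded: "bounded_seminorm S (\<lambda>a. absK (ev r a))"
proof -
  interpret E: ring_hom_ring S K "ev r" by (rule ev_ring_hom)
  show ?thesis
  proof
    show "multiplicative_seminorm S (\<lambda>a. absK (ev r a))"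
      using V.minus_le by (auto simp: multiplicative_seminorm_def absK_nonneg absK_mult V.zero S.minus_eq K.minus_eq)
    show "absK (ev r a) \<le> 1" if "a \<in> carrier S" for a
    proof -
      have "rnorm S a \<le> 1" unfolding rnorm_S_le_iff using rnorm_Zp_le_1 by blast
      then show ?thesis using absK_ev_le[OF that] by simp
    qed
  qed (simp add: absK_one)
qed

lemma alpha_root_eq:
  "alpha_root p N G u K \<iota> r \<omega> = (\<lambda>a\<in>carrier S. absK (ev r a) powr \<omega>)"
  unfolding alpha_root_def
proof (intro restrict_ext arg_cong2[where f = "(powr)"] refl arg_cong[where f = absK])
  fix a assume a: "a \<in> carrier S"
  have bij: "inj_on (\<lambda>l::nat. u [^] l) {..<p ^ N}" "(\<lambda>l::nat. u [^] l) ` {..<p ^ N} = carrier G"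
    using bij_pow by (auto simp: bij_betw_def)
  have "ev r a = (\<Oplus>\<^bsub>K\<^esub>l\<in>{..<p ^ N}. \<iota> (a (u [^] l)) \<otimes>\<^bsub>K\<^esub> character r (u [^] l))"
    unfolding evaluation_def using a character_hom(1)
    by (subst bij(2)[symmetric], subst K.finsum_reindex) (auto simp: bij)
  also have "\<dots> = (\<Oplus>\<^bsub>K\<^esub>l\<in>{..<p ^ N}. \<iota> (a (u [^] l)) \<otimes>\<^bsub>K\<^esub> r [^]\<^bsub>K\<^esub> l)"
    by (simp add: character_pow)
  finally show "(\<Oplus>\<^bsub>K\<^esub>l\<in>{..<p ^ N}. \<iota> (a (u [^] l)) \<otimes>\<^bsub>K\<^esub> r [^]\<^bsub>K\<^esub> l) = ev r a" by simp
qed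

end

end

section \<open>The points of the spectrum\<close>

context cyclic_p_group
begin

text \<open>
  The seminorm is the trivial absolute value of the residue field, pulled back along the ring
  homomorphism that reduces the coefficients and sends \<open>u\<close> to 1.
\<close>

lemma beta_bounded: "bounded_seminorm S (beta_bar p N G u)" and beta_P: "beta_bar p N G u P = 0"
proof -
  let ?k = "residue_ring (int p)"
  interpret k: field ?k by (rule residue_ring_field)
  interpret \<rho>: ring_hom_cring "Zp p" ?k Zp_residue
    by unfold_locales (rule Zp_residue_hom)
  let ?e = "evaluation ?k Zp_residue (\<lambda>g. \<one>\<^bsub>?k\<^esub>)"
  interpret E: ring_hom_ring S ?k ?e
    by (intro ring_hom_ringI2 S.ring_axioms k.ring_axioms evaluation_hom[OF k.cring_axioms Zp_residue_hom]) auto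
  have eq: "beta_bar p N G u a = trivial_norm ?k (?e a)" if a: "a \<in> carrier S" for a
  proof -
    have bij: "inj_on (\<lambda>l::nat. u [^] l) {..<p ^ N}" "(\<lambda>l::nat. u [^] l) ` {..<p ^ N} = carrier G"
      using bij_pow by (auto simp: bij_betw_def)
    have "?e a = (\<Oplus>\<^bsub>?k\<^esub>g\<in>carrier G. Zp_residue (a g))"
      unfolding evaluation_def using a by (intro k.finsum_cong') auto
    also have "\<dots> = (\<Oplus>\<^bsub>?k\<^esub>l\<in>{..<p ^ N}. Zp_residue (a (u [^] l)))"
      using a by (subst bij(2)[symmetric], subst k.finsum_reindex) (auto simp: bij)
    finally show ?thesis using a by (simp add: beta_bar_def)
  qed
  have "bounded_seminorm S (\<lambda>a. trivial_norm ?k (?e a))"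
  proof
    show "multiplicative_seminorm S (\<lambda>a. trivial_norm ?k (?e a))"
      unfolding multiplicative_seminorm_def
    proof (intro conjI ballI)
      fix a b assume "a \<in> carrier S" "b \<in> carrier S"
      then show "trivial_norm ?k (?e (a \<ominus>\<^bsub>S\<^esub> b)) \<le> trivial_norm ?k (?e a) + trivial_norm ?k (?e b)"
        "trivial_norm ?k (?e (a \<otimes>\<^bsub>S\<^esub> b)) = trivial_norm ?k (?e a) * trivial_norm ?k (?e b)"
        by (auto simp: trivial_norm_def S.minus_eq k.integral_iff)
    qed (auto simp: trivial_norm_def)
  qed (auto simp: trivial_norm_def)
  then show "bounded_seminorm S (beta_bar p N G u)" by (rule bounded_seminorm_cong) (rule eq)
  have "[p] \<cdot>\<^bsub>?k\<^esub> \<one>\<^bsub>?k\<^esub> = Zp_residue ([p] \<cdot>\<^bsub>Zp p\<^esub> \<one>\<^bsub>Zp p\<^esub>)" by (rule \<rho>.ring.hom_of_nat[symmetric])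
  also have "\<dots> = \<zero>\<^bsub>?k\<^esub>" unfolding Zp_of_nat by (simp add: Zp_residue_def residue_ring_def)
  finally have "?e P = \<zero>\<^bsub>?k\<^esub>" unfolding P_def by (simp add: E.hom_of_nat)
  then show "beta_bar p N G u P = 0" using eq[OF P_closed] by (simp add: trivial_norm_def)
qed

end

context padic_group_ring
begin

definition root :: "nat \<Rightarrow> 'c" where
  "root k = (SOME r. ring.is_root K (q_poly K p k) r)"

lemma root: "root k \<in> carrier K" "q_at K p k (root k) = \<zero>\<^bsub>K\<^esub>"
proof -
  have "\<exists>r. ring.is_root K (q_poly K p k) r" using q_at_root_exists is_root_iff by blast
  then have "ring.is_root K (q_poly K p k) (root k)" unfolding root_def by (rule someI_ex)
  then show "root k \<in> carrier K" "q_at K p k (root k) = \<zero>\<^bsub>K\<^esub>" using is_root_iff by auto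
qed

lemma seminorm_at_root:
  assumes r: "r \<in> carrier K" "q_at K p k r = \<zero>\<^bsub>K\<^esub>" and k: "k \<le> N"
  shows "bounded_seminorm S (\<lambda>a. absK (ev r a))"
    "absK (ev r (q_at S p k U)) = 0" "absK (ev r P) = 1 / real p"
proof -
  note rN = root_pow[OF r k]
  show "bounded_seminorm S (\<lambda>a. absK (ev r a))" by (rule absK_ev_bounded[OF r(1) rN])
  show "absK (ev r (q_at S p k U)) = 0" unfolding ev_q_at[OF r(1) rN] r(2) by (rule V.zero)
  show "absK (ev r P) = 1 / real p" unfolding ev_P[OF r(1) rN] by (rule absK_p)
qed

abbreviation \<alpha> :: "nat \<Rightarrow> ('g \<Rightarrow> nat \<Rightarrow> int) \<Rightarrow> real" where
  "\<alpha> k a \<equiv> absK (ev (root k) a)"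

lemma alpha_bar_eq:
  "k \<le> N \<Longrightarrow> alpha_bar p N G u K \<iota> k \<omega> = (\<lambda>a\<in>carrier S. \<alpha> k a powr \<omega>)"
  unfolding alpha_bar_def root_def[symmetric] by (intro alpha_root_eq root(1) root_pow[OF root])

lemma p_bounds: "0 < 1 / real p" "1 / real p < 1"
  using p_gt_1 by auto

text \<open>
  Two roots of \<open>q\<^sub>k\<close> give seminorms that both vanish at \<open>q\<^sub>k(u)\<close> and agree at \<open>p\<close>, so they are equal.
\<close>

lemma alpha_independent:
  assumes r: "r \<in> carrier K" "q_at K p k r = \<zero>\<^bsub>K\<^esub>" and k: "k \<le> N"
  shows "alpha_root p N G u K \<iota> r \<omega> = alpha_bar p N G u K \<iota> k \<omega>"
proof -
  have "absK (ev r a) = \<alpha> k a powr 1" if "a \<in> carrier S" for a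
    by (rule determined_on_component[OF seminorm_at_root(1,2)[OF r k] seminorm_at_root(1,2)[OF root k]])
      (use that seminorm_at_root(3)[OF r k] seminorm_at_root(3)[OF root k] p_bounds in auto)
  then have "absK (ev r a) = \<alpha> k a" if "a \<in> carrier S" for a
    using that seminormed_cring.nonneg[OF bounded_seminorm.axioms(1)[OF seminorm_at_root(1)[OF root k]] that]
    by simp
  then show ?thesis
    unfolding alpha_root_eq[OF r(1) root_pow[OF r k]] alpha_bar_eq[OF k]
    by (intro restrict_ext) simp
qed

lemma alpha_P: "k \<le> N \<Longrightarrow> alpha_bar p N G u K \<iota> k \<omega> P = (1 / real p) powr \<omega>"
  using seminorm_at_root(3)[OF root] by (simp add: alpha_bar_eq)

text \<open>
  A root of \<open>q\<^sub>k\<close> is a root of unity of exact order \<open>p ^ k\<close>, so for \<open>j < k\<close> the element \<open>u ^ (p ^ j) - 1\<close>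
  is killed on the \<open>j\<close>-th component, but not on the \<open>k\<close>-th.
\<close>

lemma alpha_separates:
  assumes "j < k" "k \<le> N"
  shows "alpha_bar p N G u K \<iota> j \<omega> (U [^]\<^bsub>S\<^esub> (p ^ j) \<ominus>\<^bsub>S\<^esub> \<one>\<^bsub>S\<^esub>) = 0"
    "alpha_bar p N G u K \<iota> k \<omega>' (U [^]\<^bsub>S\<^esub> (p ^ j) \<ominus>\<^bsub>S\<^esub> \<one>\<^bsub>S\<^esub>) \<noteq> 0"
proof -
  have ev: "ev (root i) (U [^]\<^bsub>S\<^esub> (p ^ j) \<ominus>\<^bsub>S\<^esub> \<one>\<^bsub>S\<^esub>) = root i [^]\<^bsub>K\<^esub> (p ^ j) \<ominus>\<^bsub>K\<^esub> \<one>\<^bsub>K\<^esub>"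
    if i: "i \<le> N" for i
  proof -
    interpret E: ring_hom_ring S K "ev (root i)"
      by (rule ev_ring_hom[OF root(1) root_pow[OF root i]])
    show ?thesis
      by (simp add: S.minus_eq K.minus_eq E.hom_nat_pow ev_U[OF root(1) root_pow[OF root i]])
  qed
  have "root j [^]\<^bsub>K\<^esub> (p ^ j) = \<one>\<^bsub>K\<^esub>" using root_pow[OF root] by simp
  then show "alpha_bar p N G u K \<iota> j \<omega> (U [^]\<^bsub>S\<^esub> (p ^ j) \<ominus>\<^bsub>S\<^esub> \<one>\<^bsub>S\<^esub>) = 0"
    using assms ev[of j] V.zero by (simp add: alpha_bar_eq K.minus_eq K.r_neg)
  have "root k [^]\<^bsub>K\<^esub> (p ^ j) \<noteq> \<one>\<^bsub>K\<^esub>" using root_pow_less[OF root \<open>j < k\<close>] .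
  then show "alpha_bar p N G u K \<iota> k \<omega>' (U [^]\<^bsub>S\<^esub> (p ^ j) \<ominus>\<^bsub>S\<^esub> \<one>\<^bsub>S\<^esub>) \<noteq> 0"
    using assms ev[of k] root(1) by (simp add: alpha_bar_eq absK_zero_iff)
qed

lemma alpha_distinct:
  assumes "k \<le> N" "k' \<le> N" "k \<noteq> k'"
  shows "alpha_bar p N G u K \<iota> k \<omega> \<noteq> alpha_bar p N G u K \<iota> k' \<omega>'"
  using alpha_separates[of k k'] alpha_separates[of k' k] assms by (metis linorder_neqE_nat)

text \<open>
  This expresses \<open>\<beta>\<^sub>1\<close> as the limit of \<open>\<alpha>\<^sub>k powr \<omega>\<close> for \<open>\<omega> \<rightarrow> \<infinity>\<close>, for every \<open>k\<close>: it is the reason why the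
  infinite ends of all intervals coincide.
\<close>

lemma beta_residual:
  assumes "k \<le> N" "a \<in> carrier S"
  shows "beta_bar p N G u a = (if \<alpha> k a < 1 then 0 else 1)"
  using D.residual_seminorm[OF seminorm_at_root(1)[OF root assms(1)] _ beta_bounded beta_P assms(2)]
    seminorm_at_root(3)[OF root assms(1)] p_bounds by simp

lemma alpha_range:
  assumes "k \<le> N" "a \<in> carrier S"
  shows "0 \<le> \<alpha> k a" "\<alpha> k a \<le> 1" "\<alpha> k a \<le> rnorm S a"
proof -
  interpret bounded_seminorm S "\<alpha> k" by (rule seminorm_at_root(1)[OF root assms(1)])
  show "0 \<le> \<alpha> k a" "\<alpha> k a \<le> 1" using nonneg le_one assms by auto
  show "\<alpha> k a \<le> rnorm S a" using absK_ev_le[OF root(1) root_pow[OF root assms(1)]] assms by auto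
qed

lemma berkovich_pointI:
  assumes "\<nu> \<in> extensional (carrier S)" "bounded_seminorm S \<nu>"
    "\<And>a. a \<in> carrier S \<Longrightarrow> \<nu> a \<le> rnorm S a"
  shows "\<nu> \<in> berkovich_points S"
proof -
  interpret bounded_seminorm S \<nu> by fact
  have "\<exists>a\<in>carrier S. \<nu> a \<noteq> 0" using one_one by (intro bexI[of _ "\<one>\<^bsub>S\<^esub>"]) auto
  then show ?thesis using assms seminorm by (simp add: berkovich_points_def)
qed

lemma alpha_in_berkovich:
  assumes k: "k \<le> N" and \<omega>: "1 \<le> \<omega>"
  shows "alpha_bar p N G u K \<iota> k \<omega> \<in> berkovich_points S"
proof (rule berkovich_pointI)
  show "alpha_bar p N G u K \<iota> k \<omega> \<in> extensional (carrier S)" by (simp add: alpha_bar_eq[OF k])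
  have "bounded_seminorm S (\<lambda>a. \<alpha> k a powr \<omega>)"
    using bounded_seminorm.bounded_seminorm_powr[OF seminorm_at_root(1)[OF root k]] \<omega> by simp
  then show "bounded_seminorm S (alpha_bar p N G u K \<iota> k \<omega>)"
    by (rule bounded_seminorm_cong) (simp add: alpha_bar_eq[OF k])
  fix a assume a: "a \<in> carrier S"
  have "\<alpha> k a powr \<omega> \<le> \<alpha> k a powr 1"
    using alpha_range[OF k a] \<omega> by (intro powr_mono') auto
  then show "alpha_bar p N G u K \<iota> k \<omega> a \<le> rnorm S a"
    using alpha_range[OF k a] a by (simp add: alpha_bar_eq[OF k])
qed

lemma beta_in_berkovich: "beta_bar p N G u \<in> berkovich_points S"
proof (rule berkovich_pointI)
  show "beta_bar p N G u \<in> extensional (carrier S)" by (simp add: beta_bar_def)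
  show "beta_bar p N G u a \<le> rnorm S a" if "a \<in> carrier S" for a
    using beta_residual[of 0 a] alpha_range[of 0 a] that by auto
qed (rule beta_bounded)

lemma berkovich_classification:
  assumes \<nu>: "\<nu> \<in> berkovich_points S"
  shows "\<nu> = beta_bar p N G u \<or> (\<exists>k\<le>N. \<exists>\<omega>\<ge>1. \<nu> = alpha_bar p N G u K \<iota> k \<omega>)"
proof (cases "\<nu> P = 0")
  case True
  have "\<nu> a = beta_bar p N G u a" if a: "a \<in> carrier S" for a
    using D.residual_seminorm[OF beta_bounded _ berkovich_bounded(1)[OF \<nu>] True a]
      D.residual_seminorm[OF beta_bounded _ beta_bounded beta_P a] beta_P by simp
  moreover have "\<nu> \<in> extensional (carrier S)" "beta_bar p N G u \<in> extensional (carrier S)"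
    using \<nu> by (auto simp: berkovich_points_def beta_bar_def)
  ultimately show ?thesis using extensionalityI by blast
next
  case False
  interpret bounded_seminorm S \<nu> by (rule berkovich_bounded(1)[OF \<nu>])
  have \<nu>P: "0 < \<nu> P" "\<nu> P \<le> 1 / real p"
    using False nonneg[OF P_closed] berkovich_bounded(2)[OF \<nu>] by auto
  \<comment> \<open>Contractivity at \<open>p\<close> is exactly the bound \<open>1 \<le> \<omega>\<close>.\<close>
  define \<omega> where "\<omega> = log (1 / real p) (\<nu> P)"
  have powr: "(1 / real p) powr \<omega> = \<nu> P" unfolding \<omega>_def
    using \<nu>P p_bounds by (intro powr_log_cancel) auto
  have \<omega>: "1 \<le> \<omega>"
  proof (rule ccontr)
    assume "\<not> 1 \<le> \<omega>"
    then have "(1 / real p) powr 1 < (1 / real p) powr \<omega>"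
      using p_bounds by (intro powr_less_mono') auto
    then show False using powr \<nu>P p_bounds by simp
  qed
  obtain k where k: "k \<le> N" "\<nu> (q_at S p k U) = 0"
    using component_exists[OF bounded_seminorm_axioms] by blast
  have "\<nu> a = \<alpha> k a powr \<omega>" if "a \<in> carrier S" for a
    using determined_on_component[OF bounded_seminorm_axioms k(2) seminorm_at_root(1,2)[OF root k(1)], of \<omega>]
      seminorm_at_root(3)[OF root k(1)] p_bounds \<omega> powr that by simp
  moreover have "\<nu> \<in> extensional (carrier S)" using \<nu> by (simp add: berkovich_points_def)
  ultimately have "\<nu> = alpha_bar p N G u K \<iota> k \<omega>"
    unfolding alpha_bar_eq[OF k(1)] by (intro extensionalityI[of _ "carrier S"]) auto
  then show ?thesis using k \<omega> by blast
qed

lemma berkovich_points_eq: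
  "berkovich_points S =
    {alpha_bar p N G u K \<iota> k \<omega> | k \<omega>. k \<le> N \<and> 1 \<le> \<omega>} \<union> {beta_bar p N G u}"
  using berkovich_classification alpha_in_berkovich beta_in_berkovich by blast

end

section \<open>The topology of the spectrum\<close>

lemma continuous_on_powr_ereal:
  fixes a :: real
  assumes "0 \<le> a" "a \<le> 1"
  shows "continuous_on {1..\<infinity>::ereal}
    (\<lambda>w. if w = \<infinity> then (if a < 1 then 0 else 1) else a powr real_of_ereal w)"
proof -
  consider "a = 0" | "a = 1" | "0 < a" "a < 1" using assms by linarith
  then show ?thesis
  proof cases
    case 3
    let ?f = "\<lambda>w. if w = \<infinity> then (if a < 1 then 0 else 1) else a powr real_of_ereal w"
    have "((\<lambda>r. a powr r) \<longlongrightarrow> 0) at_top" using 3 by real_asymp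
    then have lim: "(((\<lambda>r. a powr r) \<circ> real_of_ereal) \<longlongrightarrow> 0) (at_left (\<infinity>::ereal))"
      by (simp add: ereal_tendsto_simps1(3))
    have "(?f \<longlongrightarrow> 0) (at_left (\<infinity>::ereal))"
    proof (rule Lim_transform_eventually[OF lim])
      show "\<forall>\<^sub>F w in at_left (\<infinity>::ereal). ((\<lambda>r. a powr r) \<circ> real_of_ereal) w = ?f w"
        by (auto simp: eventually_at_filter)
    qed
    moreover have "at (\<infinity>::ereal) within {1..\<infinity>} \<le> at_left \<infinity>"
      unfolding at_within_def by (intro inf_mono order_refl) (auto simp: less_le)
    ultimately have "(?f \<longlongrightarrow> 0) (at (\<infinity>::ereal) within {1..\<infinity>})"
      using tendsto_mono by blast
    then have at_inf: "continuous (at \<infinity> within {1..\<infinity>}) ?f"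
      using 3 by (simp add: continuous_within)
    have cont: "isCont ?f w" if w: "w \<in> {1..\<infinity>}" "w \<noteq> \<infinity>" for w :: ereal
    proof -
      have o: "open (UNIV - {\<infinity>, -\<infinity>::ereal})" by (simp add: open_Diff)
      have "w \<in> UNIV - {\<infinity>, -\<infinity>::ereal}" using w by auto
      moreover have "continuous_on (UNIV - {\<infinity>, -\<infinity>::ereal}) ?f"
        by (rule continuous_on_eq[of _ "\<lambda>w. a powr real_of_ereal w"])
          (use 3 in \<open>auto intro!: continuous_intros continuous_on_real\<close>)
      ultimately show ?thesis using continuous_on_eq_continuous_at[OF o] by blast
    qed
    show ?thesis
      unfolding continuous_on_eq_continuous_within
    proof
      fix w :: ereal assume w: "w \<in> {1..\<infinity>}"
      show "continuous (at w within {1..\<infinity>}) ?f"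
        using at_inf continuous_at_imp_continuous_at_within[OF cont[OF w]] by (cases "w = \<infinity>") simp_all
    qed
  qed (auto simp: if_distrib[of "\<lambda>x. _ = x"] intro!: continuous_on_cong[THEN iffD2, OF refl _ continuous_on_const])
qed

lemma compact_space_sum_topology:
  assumes "finite I" "\<And>i. i \<in> I \<Longrightarrow> compact_space (T i)"
  shows "compact_space (sum_topology T I)"
proof -
  have "compactin (sum_topology T I) (\<Union>i\<in>I. Pair i ` topspace (T i))"
  proof (rule compactin_Union)
    fix C assume "C \<in> (\<lambda>i. Pair i ` topspace (T i)) ` I"
    then show "compactin (sum_topology T I) C"
      using assms(2) by (auto simp: compact_space_def intro!: image_compactin continuous_map_component_injection)
  qed (use assms in auto)
  moreover have "(\<Union>i\<in>I. Pair i ` topspace (T i)) = topspace (sum_topology T I)" by auto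
  ultimately show ?thesis by (simp add: compact_space_def)
qed

lemma continuous_map_from_sum_topology:
  assumes "\<And>i. i \<in> I \<Longrightarrow> continuous_map (T i) Y (f i)"
  shows "continuous_map (sum_topology T I) Y (\<lambda>(i, x). f i x)"
  unfolding continuous_map_def
proof (intro conjI allI impI)
  show "(\<lambda>(i, x). f i x) \<in> topspace (sum_topology T I) \<rightarrow> topspace Y"
    using assms[THEN continuous_map_funspace] by fastforce
  fix V assume "openin Y V"
  then have "openin (T i) {x \<in> topspace (T i). f i x \<in> V}" if "i \<in> I" for i
    using assms[OF that] by (simp add: continuous_map_def)
  then show "openin (sum_topology T I) {z \<in> topspace (sum_topology T I). (\<lambda>(i, x). f i x) z \<in> V}"
    by (auto simp: openin_sum_topology)
qed

context padic_group_ring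
begin

abbreviation point where "point \<equiv> interval_point p N G u K \<iota>"

text \<open>
  The value at \<open>p\<close> recovers the parameter \<open>w\<close>.
\<close>

lemma point_eq_iff:
  assumes k: "k \<le> N" "k' \<le> N" and w: "w \<in> {1..\<infinity>}" "w' \<in> {1..\<infinity>}"
  shows "point k w = point k' w' \<longleftrightarrow> (k = k' \<and> w = w') \<or> (w = \<infinity> \<and> w' = \<infinity>)"
proof -
  have P: "point j v P = (if v = \<infinity> then 0 else (1 / real p) powr real_of_ereal v)" if "j \<le> N" for j v
    using alpha_P[OF that] beta_P by (simp add: interval_point_def)
  have "w = w'" if eq: "point k w = point k' w'"
  proof -
    have e: "(if w = \<infinity> then 0 else (1 / real p) powr real_of_ereal w) =
        (if w' = \<infinity> then 0 else (1 / real p) powr real_of_ereal w')"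
      using arg_cong[OF eq, of "\<lambda>f. f P"] P k by simp
    show ?thesis
    proof (cases "w = \<infinity> \<or> w' = \<infinity>")
      case True
      then show ?thesis using e p_gt_1 by (auto split: if_splits)
    next
      case False
      then have "real_of_ereal w = real_of_ereal w'" using e p_bounds powr_inj[of "1 / real p"] by auto
      then show ?thesis using False w by (cases w; cases w') auto
    qed
  qed
  moreover have "k = k'" if "point k w = point k' w" "w \<noteq> \<infinity>"
    using that alpha_distinct[OF k] by (auto simp: interval_point_def)
  ultimately show ?thesis by (auto simp: interval_point_def)
qed

lemma topspace_spectrum: "topspace (berkovich_spectrum S) = berkovich_points S"
  unfolding berkovich_spectrum_def topspace_subtopology
  by (auto simp: berkovich_points_def PiE_def)

lemma point_image: "(\<lambda>(k, w). point k w) ` ({..N} \<times> {1..\<infinity>}) = berkovich_points S"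
proof (intro equalityI subsetI)
  fix \<nu> assume "\<nu> \<in> (\<lambda>(k, w). point k w) ` ({..N} \<times> {1..\<infinity>})"
  then obtain k w where kw: "k \<le> N" "1 \<le> w" "\<nu> = point k w" by auto
  then have "w \<noteq> \<infinity> \<Longrightarrow> 1 \<le> real_of_ereal w" by (cases w) auto
  then show "\<nu> \<in> berkovich_points S"
    using kw alpha_in_berkovich beta_in_berkovich by (auto simp: interval_point_def)
next
  fix \<nu> assume "\<nu> \<in> berkovich_points S"
  then consider "\<nu> = beta_bar p N G u" | k \<omega> where "k \<le> N" "1 \<le> \<omega>" "\<nu> = alpha_bar p N G u K \<iota> k \<omega>"
    using berkovich_classification by blast
  then show "\<nu> \<in> (\<lambda>(k, w). point k w) ` ({..N} \<times> {1..\<infinity>})"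
  proof cases
    case 1
    then show ?thesis by (intro image_eqI[of _ _ "(0, \<infinity>)"]) (auto simp: interval_point_def)
  next
    case 2
    then show ?thesis by (intro image_eqI[of _ _ "(k, ereal \<omega>)"]) (auto simp: interval_point_def)
  qed
qed

lemma point_continuous:
  assumes k: "k \<le> N"
  shows "continuous_map (top_of_set {1..\<infinity>}) (berkovich_spectrum S) (point k)"
  unfolding berkovich_spectrum_def continuous_map_in_subtopology continuous_map_componentwise
proof (intro conjI ballI)
  have img: "point k ` {1..\<infinity>} \<subseteq> berkovich_points S" using point_image k by auto
  then show "point k \<in> topspace (top_of_set {1..\<infinity>}) \<rightarrow> berkovich_points S" by auto
  show "point k ` topspace (top_of_set {1..\<infinity>}) \<subseteq> extensional (carrier S)"
    using img by (auto simp: berkovich_points_def)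
  fix a assume a: "a \<in> carrier S"
  have "(\<lambda>w. point k w a) = (\<lambda>w. if w = \<infinity> then (if \<alpha> k a < 1 then 0 else 1) else \<alpha> k a powr real_of_ereal w)"
    using a beta_residual[OF k a] by (auto simp: interval_point_def alpha_bar_eq[OF k])
  then show "continuous_map (top_of_set {1..\<infinity>}) euclideanreal (\<lambda>w. point k w a)"
    using continuous_on_powr_ereal alpha_range[OF k a] by simp
qed

lemma Hausdorff_spectrum: "Hausdorff_space (berkovich_spectrum S)"
  unfolding berkovich_spectrum_def
  by (intro Hausdorff_space_subtopology) (simp add: Hausdorff_space_product_topology)

lemma compact_interval: "compact_space (top_of_set {1..\<infinity>::ereal})"
  by (simp add: compact_space_subtopology compact_eq_closed)

lemma point_embedding:
  assumes k: "k \<le> N"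
  shows "embedding_map (top_of_set {1..\<infinity>}) (berkovich_spectrum S) (point k)"
  using continuous_imp_embedding_map[OF point_continuous[OF k] compact_interval Hausdorff_spectrum]
    point_eq_iff[OF k k] by (auto simp: inj_on_def)

lemma point_quotient:
  "quotient_map (sum_topology (\<lambda>_. top_of_set {1..\<infinity>}) {..N}) (berkovich_spectrum S)
    (\<lambda>(k, w). point k w)"
proof (rule continuous_imp_quotient_map)
  show "continuous_map (sum_topology (\<lambda>_. top_of_set {1..\<infinity>}) {..N}) (berkovich_spectrum S)
      (\<lambda>(k, w). point k w)"
    using point_continuous by (intro continuous_map_from_sum_topology) auto
  show "(\<lambda>(k, w). point k w) ` topspace (sum_topology (\<lambda>_. top_of_set {1..\<infinity>}) {..N}) =
      topspace (berkovich_spectrum S)"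
    using point_image by (simp add: topspace_spectrum comp_def)
qed (auto intro!: compact_space_sum_topology compact_interval Hausdorff_spectrum)

end

theorem mainTheorem6:
  fixes p N :: nat
    and G :: "('g, 'n) monoid_scheme" and u :: 'g
    and K :: "('c, 'm) normed_ring_scheme" and \<iota> :: "(nat \<Rightarrow> int) \<Rightarrow> 'c"
  assumes "Factorial_Ring.prime p" and "N \<ge> 1"
    and "group G" and "order G = p ^ N" and "u \<in> carrier G" and "generate G {u} = carrier G"
    and "is_Cp p K \<iota>"
  shows
    "(\<forall>k\<le>N. \<exists>r. ring.is_root K (q_poly K p k) r) \<and>
     (\<forall>k\<le>N. \<forall>\<omega>\<ge>1. \<forall>r. ring.is_root K (q_poly K p k) r \<longrightarrow>
        alpha_root p N G u K \<iota> r \<omega> = alpha_bar p N G u K \<iota> k \<omega>) \<and>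
     berkovich_points (group_ring (Zp p) G) =
       {alpha_bar p N G u K \<iota> k \<omega> | k \<omega>. k \<le> N \<and> 1 \<le> \<omega>} \<union> {beta_bar p N G u} \<and>
     (\<forall>k\<le>N. \<forall>k'\<le>N. \<forall>\<omega>\<ge>1. \<forall>\<omega>'\<ge>1. k \<noteq> k' \<longrightarrow>
        alpha_bar p N G u K \<iota> k \<omega> \<noteq> alpha_bar p N G u K \<iota> k' \<omega>') \<and>
     (\<forall>k\<le>N. embedding_map (top_of_set {1..\<infinity>}) (berkovich_spectrum (group_ring (Zp p) G))
        (interval_point p N G u K \<iota> k)) \<and>
     quotient_map (sum_topology (\<lambda>_. top_of_set {1..\<infinity>}) {..N})
        (berkovich_spectrum (group_ring (Zp p) G))
        (\<lambda>(k, w). interval_point p N G u K \<iota> k w) \<and>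
     (\<forall>k\<le>N. \<forall>k'\<le>N. \<forall>w\<in>{1..\<infinity>}. \<forall>w'\<in>{1..\<infinity>}.
        interval_point p N G u K \<iota> k w = interval_point p N G u K \<iota> k' w' \<longleftrightarrow>
          (k = k' \<and> w = w') \<or> (w = \<infinity> \<and> w' = \<infinity>))"
proof -
  interpret padic_group_ring p G N u K \<iota>
    using assms by (simp add: padic_group_ring_def padic_group_ring_axioms_def cyclic_p_group_def
        cyclic_p_group_axioms_def padic_def)
  show ?thesis
  proof (intro conjI)
    show "\<forall>k\<le>N. \<exists>r. ring.is_root K (q_poly K p k) r"
      using q_at_root_exists by (auto simp: is_root_iff)
    show "\<forall>k\<le>N. \<forall>\<omega>\<ge>1. \<forall>r. ring.is_root K (q_poly K p k) r \<longrightarrow>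
        alpha_root p N G u K \<iota> r \<omega> = alpha_bar p N G u K \<iota> k \<omega>"
      using alpha_independent by (auto simp: is_root_iff)
    show "\<forall>k\<le>N. \<forall>k'\<le>N. \<forall>\<omega>\<ge>1. \<forall>\<omega>'\<ge>1. k \<noteq> k' \<longrightarrow>
        alpha_bar p N G u K \<iota> k \<omega> \<noteq> alpha_bar p N G u K \<iota> k' \<omega>'"
      by (intro allI impI alpha_distinct)
    show "\<forall>k\<le>N. \<forall>k'\<le>N. \<forall>w\<in>{1..\<infinity>}. \<forall>w'\<in>{1..\<infinity>}.
        interval_point p N G u K \<iota> k w = interval_point p N G u K \<iota> k' w' \<longleftrightarrow>
          (k = k' \<and> w = w') \<or> (w = \<infinity> \<and> w' = \<infinity>)"
      by (intro allI impI ballI point_eq_iff)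
    show "berkovich_points S =
        {alpha_bar p N G u K \<iota> k \<omega> | k \<omega>. k \<le> N \<and> 1 \<le> \<omega>} \<union> {beta_bar p N G u}"
      by (rule berkovich_points_eq)
  qed (intro allI impI point_embedding, assumption, rule point_quotient)
qed

end
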